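(* Let $C$ be a closed convex cone in $H$, $K$ a nonempty closed convex subset of $C$, and let $f:C\to H$ and $g:H\to H$ be weakly homogeneous mappings of degrees $\delta_1>0$ and $\delta_2>0$, respectively, written $f=f^\infty+\bar f+p$ and $g=g^\infty+\bar g+q$. Let $F,F^\infty:H\to H$ be any given continuous extensions of $f$ and $f^\infty$, respectively. Suppose that $g^{-1}(C)\subseteq C$, that $\bar g(x)+q\in C$ as $\|x\|\to\infty$ (i.e. for all $x\in H$ with $\|x\|$ sufficiently large), and that the following conditions hold: (a) SOL$(f^\infty,g^\infty,K^\infty)=\{0\}$; and (b) $\mathrm{ind}\big((F^\infty,g^\infty)^{nat}_{K^\infty},0\big)\ne 0$, where $(F^\infty,g^\infty)^{nat}_{K^\infty}(x):=g^\infty(x)-\Pi_{K^\infty}[g^\infty(x)-F^\infty(x)]$ for $x\in H$. Then WHGVI$(f,g,K)$ and WHGCP$(f,g,K^\infty)$ have nonempty compact solution sets.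
   Context: $H$ is a finite dimensional real Hilbert space with inner product $\langle\cdot,\cdot\rangle$ and norm $\|\cdot\|$; $\Pi_S$ is the orthogonal projection onto a closed convex set $S$; $g^{-1}(C)=\{x\in H\mid g(x)\in C\}$; the dual cone of $S$ is $S^*=\{u\in H\mid \langle u,x\rangle\ge0\ \forall x\in S\}$; the recession cone of $K$ is $K^\infty:=\{u\in H\mid \exists t_k\to\infty,\ \exists x^k\in K \text{ such that } x^k/t_k\to u\}$. Weakly homogeneous mappings: let $D\subseteq H$ be a closed convex cone ($D=C$ for $f$, $D=H$ for $g$). A continuous $h:D\to H$ is positively homogeneous of degree $\delta$ if $h(\lambda x)=\lambda^\delta h(x)$ for all $x\in D$, $\lambda>0$. A mapping $\varphi:D\to H$ is weakly homogeneous of degree $\delta>0$ if $\varphi=h+e$ with $h$ positively homogeneous of degree $\delta$ and $e:D\to H$ continuous with $e(x)/\|x\|^\delta\to0$ as $\|x\|\to\infty$ in $D$; $h$ is unique, is called the leading term and is denoted $\varphi^\infty$. In $f=f^\infty+\bar f+p$, $p\in H$ is the constant item and $\bar f:=f-f^\infty-p$; likewise $q\in H$ and $\bar g:=g-g^\infty-q$, so $\bar g+q=g-g^\infty$. For mappings $\phi$ (on $C$ or $H$), $\psi:H\to H$ and closed convex $S$, SOL$(\phi,\psi,S)$ is the set of $x$ such that $\psi(x)\in S$ and $\langle\phi(x),y-\psi(x)\rangle\ge0$ for all $y\in S$; if $S$ is a cone this is equivalent to $\psi(x)\in S$, $\phi(x)\in S^*$, $\langle\phi(x),\psi(x)\rangle=0$.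 WHGVI$(f,g,K)$ is the problem with solution set SOL$(f,g,K)$, and WHGCP$(f,g,K^\infty)$ is the problem of finding $x\in H$ with $g(x)\in K^\infty$, $f(x)\in(K^\infty)^*$, $\langle f(x),g(x)\rangle=0$. If $x^*$ is an isolated zero of a continuous $\phi:H\to H$, $\mathrm{ind}(\phi,x^* )$ is the topological (Brouwer) degree $\deg(\phi,\Omega',0)$ for any bounded open $\Omega'\ni x^*$ such that $x^*$ is the only zero of $\phi$ in $\bar{\Omega'}$. *)

theory Defs
  imports "HOL-Analysis.Analysis" "HOL-Homology.Homology"
begin

section \<open>Cones, weakly homogeneous mappings, variational inequalities\<close>

definition recession_cone :: "'a::real_normed_vector set \<Rightarrow> 'a set" where
  "recession_cone K =
     {u. \<exists>(t :: nat \<Rightarrow> real) (x :: nat \<Rightarrow> 'a).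
           filterlim t at_top sequentially \<and> (\<forall>k. x k \<in> K) \<and>
           (\<lambda>k. x k /\<^sub>R t k) \<longlonglongrightarrow> u}"

definition dual_cone :: "'a::real_inner set \<Rightarrow> 'a set" where
  "dual_cone S = {u. \<forall>x\<in>S. 0 \<le> u \<bullet> x}"

definition positively_homogeneous_on ::
    "'a::real_normed_vector set \<Rightarrow> real \<Rightarrow> ('a \<Rightarrow> 'a) \<Rightarrow> bool" where
  "positively_homogeneous_on D \<delta> h \<longleftrightarrow>
     continuous_on D h \<and> (\<forall>x\<in>D. \<forall>c>0. h (c *\<^sub>R x) = (c powr \<delta>) *\<^sub>R h x)"

text \<open>\<open>\<phi>inf\<close> is the leading term of \<open>\<phi>\<close>; for a cone \<open>D\<close> it is determined on \<open>D\<close>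
  by \<open>\<phi>\<close> and \<open>\<delta>\<close>, and it is carried as an argument since mappings on \<open>D\<close> are represented
  by total functions whose values off \<open>D\<close> are irrelevant.\<close>

definition weakly_homogeneous_on ::
    "'a::real_normed_vector set \<Rightarrow> real \<Rightarrow> ('a \<Rightarrow> 'a) \<Rightarrow> ('a \<Rightarrow> 'a) \<Rightarrow> bool" where
  "weakly_homogeneous_on D \<delta> \<phi> \<phi>inf \<longleftrightarrow>
     \<delta> > 0 \<and> positively_homogeneous_on D \<delta> \<phi>inf \<and>
     (\<exists>e. continuous_on D e \<and> (\<forall>x\<in>D. \<phi> x = \<phi>inf x + e x) \<and>
          filterlim (\<lambda>x. e x /\<^sub>R (norm x powr \<delta>)) (nhds 0) (inf at_infinity (principal D)))"

text \<open>In the two solution sets below, \<open>D\<close> is the domain of the first mapping \<open>\<phi>\<close>.\<close>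

definition SOL :: "'a::real_inner set \<Rightarrow> ('a \<Rightarrow> 'a) \<Rightarrow> ('a \<Rightarrow> 'a) \<Rightarrow> 'a set \<Rightarrow> 'a set" where
  "SOL D \<phi> \<psi> S = {x \<in> D. \<psi> x \<in> S \<and> (\<forall>y\<in>S. 0 \<le> \<phi> x \<bullet> (y - \<psi> x))}"

definition GCP_solutions ::
    "'a::real_inner set \<Rightarrow> ('a \<Rightarrow> 'a) \<Rightarrow> ('a \<Rightarrow> 'a) \<Rightarrow> 'a set \<Rightarrow> 'a set" where
  "GCP_solutions D \<phi> \<psi> S = {x \<in> D. \<psi> x \<in> S \<and> \<phi> x \<in> dual_cone S \<and> \<phi> x \<bullet> \<psi> x = 0}"

definition natural_map ::
    "('a::euclidean_space \<Rightarrow> 'a) \<Rightarrow> ('a \<Rightarrow> 'a) \<Rightarrow> 'a set \<Rightarrow> 'a \<Rightarrow> 'a" where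
  "natural_map \<phi> \<psi> S x = \<psi> x - closest_point S (\<psi> x - \<phi> x)"


section \<open>Brouwer degree and index of an isolated zero\<close>

text \<open>The library provides the (homological) degree of self-maps of the sphere
  \<^term>\<open>nsphere n\<close>.  The degree of \<open>\<phi>\<close> on a bounded open set \<open>\<Omega>\<close> at \<open>y \<notin> \<phi> ` frontier \<Omega>\<close>
  is defined from it as the degree of a self-map of the one-point compactification
  of the space: with \<open>r\<close> the distance of \<open>y\<close> from \<open>\<phi> ` frontier \<Omega>\<close>, the points of \<open>\<Omega>\<close>
  mapped into \<open>ball y r\<close> are sent on by the radial homeomorphism of that ball onto the
  whole space, and everything else (in particular infinity) is sent to infinity.
  The result is continuous, has near each solution of \<open>\<phi> x = y\<close> in \<open>\<Omega>\<close> the same local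
  behaviour (up to an orientation-preserving homeomorphism of the target) as \<open>\<phi>\<close>, and has
  no other preimage of the origin; its degree is therefore the usual local degree
  \<open>deg(\<phi>, \<Omega>, y)\<close>, with the identity having degree 1 over each point of \<open>\<Omega>\<close>.

  The compactification is identified with \<^term>\<open>nsphere n\<close>, \<open>n\<close> the dimension,
  by stereographic projection in coordinates with respect to an enumeration of the
  standard orthonormal basis.  The same chart is used in the source and in the target,
  so the choice of the enumeration does not matter.\<close>

definition basis_enum :: "nat \<Rightarrow> 'a::euclidean_space" where
  "basis_enum = (SOME b. bij_betw b {..<DIM('a)} Basis)"

definition north_pole :: "'a::euclidean_space itself \<Rightarrow> nat \<Rightarrow> real" where
  "north_pole _ i = (if i = DIM('a) then 1 else 0)"

definition to_sphere :: "'a::euclidean_space \<Rightarrow> nat \<Rightarrow> real" where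
  "to_sphere v i =
     (if i < DIM('a) then 2 * (v \<bullet> basis_enum i) / ((norm v)\<^sup>2 + 1)
      else if i = DIM('a) then ((norm v)\<^sup>2 - 1) / ((norm v)\<^sup>2 + 1)
      else 0)"

text \<open>Inverse of \<^const>\<open>to_sphere\<close> away from the north pole.\<close>

definition from_sphere :: "(nat \<Rightarrow> real) \<Rightarrow> 'a::euclidean_space" where
  "from_sphere s = (\<Sum>i<DIM('a). (s i / (1 - s DIM('a))) *\<^sub>R basis_enum i)"

definition collapse_map ::
    "('a::euclidean_space \<Rightarrow> 'a) \<Rightarrow> 'a set \<Rightarrow> 'a \<Rightarrow> (nat \<Rightarrow> real) \<Rightarrow> nat \<Rightarrow> real" where
  "collapse_map \<phi> \<Omega> y s =
     (let r = infdist y (\<phi> ` frontier \<Omega>); x = from_sphere s; w = \<phi> x - y in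
      if s \<noteq> north_pole TYPE('a) \<and> x \<in> \<Omega> \<and> norm w < r
      then to_sphere (w /\<^sub>R (r - norm w))
      else north_pole TYPE('a))"

definition brouwer_degree ::
    "('a::euclidean_space \<Rightarrow> 'a) \<Rightarrow> 'a set \<Rightarrow> 'a \<Rightarrow> int" where
  "brouwer_degree \<phi> \<Omega> y = Brouwer_degree2 DIM('a) (collapse_map \<phi> \<Omega> y)"

text \<open>For an isolated zero \<open>x\<close> of a continuous \<open>\<phi>\<close>, all admissible neighbourhoods \<open>\<Omega>\<close>
  give the same degree (excision), and there is at least one; otherwise the value is meaningless.\<close>

definition brouwer_index :: "('a::euclidean_space \<Rightarrow> 'a) \<Rightarrow> 'a \<Rightarrow> int" where
  "brouwer_index \<phi> x =
     (THE d. \<forall>\<Omega>. open \<Omega> \<and> bounded \<Omega> \<and> x \<in> \<Omega> \<and> {z \<in> closure \<Omega>. \<phi> z = 0} = {x}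
        \<longrightarrow> brouwer_degree \<phi> \<Omega> 0 = d)"

end

theory Submission
  imports Defs
begin

text \<open>Put \<open>g\<^sub>t = (1 - t) ginf + t g\<close>, \<open>F\<^sub>t = (1 - t) Finf + t F\<close> and let \<open>S\<^sub>t\<close> be \<open>t K\<close> for
  \<open>t > 0\<close> and the recession cone of \<open>K\<close> for \<open>t = 0\<close>.  The natural maps of \<open>(F\<^sub>t, g\<^sub>t)\<close> on \<open>S\<^sub>t\<close> form a
  homotopy whose end at \<open>t = 1\<close> has \<open>SOL(f, g, K)\<close> as its zero set.  If zeros with norms tending to
  infinity existed, then dividing by the norms and passing to the limit would produce a solution of
  norm 1 of the limit problem, which only has the solution 0.  So all zeros lie in a fixed ball, and
  if the map at \<open>t = 1\<close> had no zero, the collapse map of the map at \<open>t = 0\<close> on any admissible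
  neighbourhood of 0 would be homotopic to a constant, and the index would vanish.
  The complementarity problem is the case where \<open>K\<close> is replaced by its recession cone.\<close>

section \<open>Homotopy and the index of an isolated zero\<close>

lemma basis_enum_bij: "bij_betw (basis_enum :: nat \<Rightarrow> 'a::euclidean_space) {..<DIM('a)} Basis"
proof -
  have "\<exists>b. bij_betw b {..<DIM('a)} (Basis :: 'a set)"
    using ex_bij_betw_nat_finite[OF finite_Basis] by (simp add: atLeast0LessThan)
  then show ?thesis
    unfolding basis_enum_def by (rule someI_ex)
qed

lemma sum_basis_enum:
  "(\<Sum>i<DIM('a). G (basis_enum i)) = (\<Sum>b\<in>Basis. G (b :: 'a::euclidean_space))"
  by (rule sum.reindex_bij_betw[OF basis_enum_bij])

lemma sum_inner_basis_enum_squared: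
  "(\<Sum>i<DIM('a). (w \<bullet> basis_enum i)\<^sup>2) = (norm (w :: 'a::euclidean_space))\<^sup>2"
  unfolding sum_basis_enum[of "\<lambda>b. (w \<bullet> b)\<^sup>2"] power2_norm_eq_inner
  by (simp add: euclidean_inner[of w w] power2_eq_square)

lemma norm_from_sphere_squared:
  fixes s :: "nat \<Rightarrow> real"
  shows "(norm (from_sphere s :: 'a::euclidean_space))\<^sup>2 = (\<Sum>i<DIM('a). (s i / (1 - s DIM('a)))\<^sup>2)"
proof -
  have coord: "(from_sphere s :: 'a) \<bullet> basis_enum j = s j / (1 - s DIM('a))" if j: "j < DIM('a)" for j
  proof -
    have "basis_enum i \<bullet> (basis_enum j :: 'a) = (if i = j then 1 else 0)" if "i < DIM('a)" for i
      using basis_enum_bij[where 'a='a] that j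
      by (auto simp: bij_betw_def inj_on_def intro!: inner_not_same_Basis inner_same_Basis)
    then have "(\<Sum>i<DIM('a). s i / (1 - s DIM('a)) * (basis_enum i \<bullet> (basis_enum j :: 'a)))
        = (\<Sum>i<DIM('a). if i = j then s i / (1 - s DIM('a)) else 0)"
      by (intro sum.cong) (simp_all split: if_splits)
    then show ?thesis
      using j by (simp add: from_sphere_def inner_sum_left)
  qed
  show ?thesis
    unfolding sum_inner_basis_enum_squared[symmetric] by (simp add: coord)
qed

text \<open>If the last coordinate is 1, the norm equation forces all others to vanish. So
  \<open>from_sphere\<close> divides by zero at the pole only.\<close>

lemma sphere_last_coord:
  assumes s: "s \<in> topspace (nsphere DIM('a::euclidean_space))" and "s \<noteq> north_pole TYPE('a)"
  shows "s DIM('a) < 1"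
proof (rule ccontr)
  let ?n = "DIM('a)"
  assume "\<not> s ?n < 1"
  then have "(s ?n)\<^sup>2 \<ge> 1"
    by simp
  have tot: "(\<Sum>i<?n. (s i)\<^sup>2) + (s ?n)\<^sup>2 = 1" and zero: "\<And>i. i > ?n \<Longrightarrow> s i = 0"
    using s by (auto simp: nsphere lessThan_Suc_atMost[symmetric])
  have "(\<Sum>i<?n. (s i)\<^sup>2) \<ge> 0"
    by (rule sum_nonneg) auto
  then have "(\<Sum>i<?n. (s i)\<^sup>2) = 0" and "(s ?n)\<^sup>2 = 1"
    using tot \<open>(s ?n)\<^sup>2 \<ge> 1\<close> by linarith+
  then have "s i = 0" if "i < ?n" for i
    using that by (simp add: sum_nonneg_eq_0_iff)
  moreover have "s ?n = 1"
    using \<open>(s ?n)\<^sup>2 = 1\<close> \<open>\<not> s ?n < 1\<close> by (auto simp: power2_eq_1_iff)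
  ultimately have "s = north_pole TYPE('a)"
    using zero by (intro ext) (metis north_pole_def linorder_neqE_nat)
  then show False
    using assms by simp
qed

text \<open>The norm equation gives \<open>(1 + s n) / (1 - s n)\<close> with
  \<open>n = DIM('a)\<close> as the squared norm of the stereographic image, and this blows up at
  the pole. The explicit threshold yields a neighbourhood of the pole that a bounded set cannot
  reach.\<close>

lemma sphere_near_north_pole:
  assumes s: "s \<in> topspace (nsphere DIM('a::euclidean_space))" "s \<noteq> north_pole TYPE('a)"
    and near: "s DIM('a) > 1 - 1 / (B\<^sup>2 + 1)"
  shows "norm (from_sphere s :: 'a) > B"
proof -
  let ?n = "DIM('a)"
  let ?d = "1 - s ?n"
  have B: "B\<^sup>2 + 1 \<ge> 1"
    by simp
  have d: "0 < ?d" "?d < 1 / (B\<^sup>2 + 1)"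
    using sphere_last_coord[OF s] near by auto
  have "1 / (B\<^sup>2 + 1) \<le> 1"
    by (subst divide_le_eq_1_pos) (use B in linarith)+
  then have sn: "s ?n > 0"
    using d by linarith
  have "(\<Sum>i<?n. (s i)\<^sup>2) + (s ?n)\<^sup>2 = 1"
    using s by (auto simp: nsphere lessThan_Suc_atMost[symmetric])
  then have "(\<Sum>i<?n. (s i)\<^sup>2) = ?d * (1 + s ?n)"
    by (simp add: algebra_simps power2_eq_square)
  moreover have "(norm (from_sphere s :: 'a))\<^sup>2 = (\<Sum>i<?n. (s i)\<^sup>2) / ?d\<^sup>2"
    by (simp add: norm_from_sphere_squared power_divide sum_divide_distrib)
  ultimately have "(norm (from_sphere s :: 'a))\<^sup>2 = (1 + s ?n) / ?d"
    using d by (simp add: power2_eq_square)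
  moreover have "(1 + s ?n) / ?d > 1 / ?d"
    using d sn by (simp add: divide_strict_right_mono)
  moreover have "1 / ?d > B\<^sup>2 + 1"
  proof -
    have "?d * (B\<^sup>2 + 1) < 1"
      using d(2) B less_le_trans[OF zero_less_one B] pos_less_divide_eq by blast
    then show ?thesis
      by (subst pos_less_divide_eq[OF d(1)]) (simp only: mult.commute)
  qed
  ultimately have "B\<^sup>2 < (norm (from_sphere s :: 'a))\<^sup>2"
    by linarith
  then show ?thesis
    by (simp add: power2_less_imp_less)
qed

text \<open>The ball of radius 1 is blown up to the whole space; everything else goes to infinity.\<close>

definition radial :: "'a::euclidean_space \<Rightarrow> nat \<Rightarrow> real" where
  "radial w = (if norm w < 1 then to_sphere (w /\<^sub>R (1 - norm w)) else north_pole TYPE('a))"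

lemma radial_far:
  fixes w :: "'a::euclidean_space"
  assumes "0 < \<rho>" "\<rho> \<le> norm w"
  shows "radial (w /\<^sub>R \<rho>) = north_pole TYPE('a)"
proof -
  have "norm (w /\<^sub>R \<rho>) = norm w / \<rho>"
    using assms by (simp add: divide_inverse_commute)
  then show ?thesis
    using assms by (simp add: radial_def)
qed

text \<open>Clearing the denominators by \<open>d\<^sup>2\<close> merges the two cases of
  \<open>radial\<close>: for \<open>norm w \<ge> 1\<close> the cutoff gives \<open>d = 0\<close>,
  and the formula returns the pole. Continuity across the unit sphere can be read off from
  it.\<close>

lemma radial_eq:
  fixes w :: "'a::euclidean_space"
  defines "d \<equiv> max 0 (1 - norm w)"
  shows "radial w i =
     (if i < DIM('a) then 2 * (w \<bullet> basis_enum i) * d / ((norm w)\<^sup>2 + d\<^sup>2)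
      else if i = DIM('a) then ((norm w)\<^sup>2 - d\<^sup>2) / ((norm w)\<^sup>2 + d\<^sup>2) else 0)"
proof (cases "norm w < 1")
  case True
  then have d: "d = 1 - norm w" "d > 0"
    by (auto simp: d_def)
  have pos: "(norm w)\<^sup>2 + d\<^sup>2 > 0"
    using d by (simp add: add_nonneg_pos)
  have nrm: "(norm (w /\<^sub>R d))\<^sup>2 = (norm w)\<^sup>2 / d\<^sup>2"
    using d by (simp add: power_divide divide_inverse_commute power_mult_distrib power_inverse)
  have "2 * ((w /\<^sub>R d) \<bullet> basis_enum i) / ((norm (w /\<^sub>R d))\<^sup>2 + 1)
      = 2 * (w \<bullet> basis_enum i) * d / ((norm w)\<^sup>2 + d\<^sup>2)"
    unfolding nrm using d pos by (simp add: field_simps power2_eq_square)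
  moreover have "((norm (w /\<^sub>R d))\<^sup>2 - 1) / ((norm (w /\<^sub>R d))\<^sup>2 + 1) = ((norm w)\<^sup>2 - d\<^sup>2) / ((norm w)\<^sup>2 + d\<^sup>2)"
    unfolding nrm using d pos by (simp add: divide_simps)
  ultimately show ?thesis
    using True by (simp add: radial_def to_sphere_def d(1)[symmetric])
next
  case False
  then show ?thesis
    by (auto simp: radial_def d_def north_pole_def)
qed

lemma radial_denominator_pos:
  fixes w :: "'a::euclidean_space"
  shows "(norm w)\<^sup>2 + (max 0 (1 - norm w))\<^sup>2 > 0"
  by (cases "w = 0") (auto simp: add_pos_nonneg)

lemma continuous_on_radial:
  assumes "continuous_on A h"
  shows "continuous_on A (\<lambda>x. radial (h x :: 'a::euclidean_space) i)"
proof -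
  have "(norm (h x))\<^sup>2 + (max 0 (1 - norm (h x)))\<^sup>2 \<noteq> 0" for x
    using radial_denominator_pos[of "h x"] by simp
  then show ?thesis
    unfolding radial_eq using assms
    by (cases "i < DIM('a)"; cases "i = DIM('a)") (auto intro!: continuous_intros)
qed

section \<open>Maps into the sphere and homotopies of collapse maps\<close>

lemma north_pole_in_nsphere: "north_pole TYPE('a::euclidean_space) \<in> topspace (nsphere DIM('a))"
  by (simp add: nsphere north_pole_def if_distrib[where f = "\<lambda>x. x\<^sup>2"] cong: if_cong)

lemma radial_in_nsphere:
  fixes w :: "'a::euclidean_space"
  shows "radial w \<in> topspace (nsphere DIM('a))"
proof -
  let ?n = "DIM('a)"
  define d where "d = max 0 (1 - norm w)"
  define m where "m = norm w"
  have pos: "m\<^sup>2 + d\<^sup>2 > 0"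
    using radial_denominator_pos[of w] by (simp add: d_def m_def)
  have "(\<Sum>i<?n. (radial w i)\<^sup>2) = (\<Sum>i<?n. (2 * d / (m\<^sup>2 + d\<^sup>2))\<^sup>2 * (w \<bullet> basis_enum i)\<^sup>2)"
    by (intro sum.cong) (auto simp: radial_eq d_def m_def power_mult_distrib power_divide)
  also have "\<dots> = (2 * d / (m\<^sup>2 + d\<^sup>2))\<^sup>2 * m\<^sup>2"
    by (simp add: sum_distrib_left[symmetric] sum_inner_basis_enum_squared m_def)
  finally have "(\<Sum>i\<le>?n. (radial w i)\<^sup>2)
      = (2 * d / (m\<^sup>2 + d\<^sup>2))\<^sup>2 * m\<^sup>2 + ((m\<^sup>2 - d\<^sup>2) / (m\<^sup>2 + d\<^sup>2))\<^sup>2"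
    by (simp add: lessThan_Suc_atMost[symmetric] radial_eq[of w ?n] d_def m_def)
  also have "\<dots> = ((2 * d * m)\<^sup>2 + (m\<^sup>2 - d\<^sup>2)\<^sup>2) / (m\<^sup>2 + d\<^sup>2)\<^sup>2"
    by (simp add: power_divide power_mult_distrib add_divide_distrib)
  also have "(2 * d * m)\<^sup>2 + (m\<^sup>2 - d\<^sup>2)\<^sup>2 = (m\<^sup>2 + d\<^sup>2)\<^sup>2"
    by (simp add: power2_eq_square algebra_simps)
  finally have "(\<Sum>i\<le>?n. (radial w i)\<^sup>2) = 1"
    using pos by auto
  then show ?thesis
    by (simp add: nsphere radial_eq)
qed

text \<open>This is \<open>collapse_map\<close> with the level normalised to 1 and absorbed into
  \<open>h\<close>, so that a homotopy may vary the map and the level together.\<close>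

definition sphere_collapse :: "('a::euclidean_space \<Rightarrow> 'a) \<Rightarrow> 'a set \<Rightarrow> (nat \<Rightarrow> real) \<Rightarrow> nat \<Rightarrow> real" where
  "sphere_collapse h \<Omega> s =
     (if s \<noteq> north_pole TYPE('a) \<and> from_sphere s \<in> \<Omega> then radial (h (from_sphere s)) else north_pole TYPE('a))"

lemma collapse_map_eq_sphere_collapse:
  fixes \<phi> :: "'a::euclidean_space \<Rightarrow> 'a"
  assumes "r = infdist y (\<phi> ` frontier \<Omega>)" "r > 0"
  shows "collapse_map \<phi> \<Omega> y = sphere_collapse (\<lambda>x. (\<phi> x - y) /\<^sub>R r) \<Omega>"
proof
  fix s
  let ?w = "\<phi> (from_sphere s) - y"
  have "1 - norm ?w / r = (r - norm ?w) / r"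
    using \<open>r > 0\<close> by (simp add: field_simps)
  then have "(?w /\<^sub>R r) /\<^sub>R (1 - norm ?w / r) = ?w /\<^sub>R (r - norm ?w)"
    using \<open>r > 0\<close> by (simp add: field_simps)
  moreover have "norm (?w /\<^sub>R r) = norm ?w / r"
    using \<open>r > 0\<close> by (simp add: divide_inverse_commute)
  moreover have "norm ?w / r < 1 \<longleftrightarrow> norm ?w < r"
    using \<open>r > 0\<close> by simp
  ultimately show "collapse_map \<phi> \<Omega> y s = sphere_collapse (\<lambda>x. (\<phi> x - y) /\<^sub>R r) \<Omega> s"
    unfolding collapse_map_def sphere_collapse_def radial_def Let_def assms(1)[symmetric] by presburger
qed

lemma continuous_map_from_sphere:
  "continuous_map (subtopology (nsphere DIM('a)) (- {north_pole TYPE('a)})) euclidean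
     (from_sphere :: _ \<Rightarrow> 'a::euclidean_space)"
proof -
  let ?X = "subtopology (nsphere DIM('a)) (- {north_pole TYPE('a)})"
  have proj: "continuous_map ?X euclideanreal (\<lambda>s. s i)" for i
    by (intro continuous_map_from_subtopology continuous_map_nsphere_projection)
  have "s DIM('a) \<noteq> 1" if "s \<in> topspace ?X" for s
    using sphere_last_coord[of s, where 'a='a] that by auto
  then have "continuous_map ?X euclideanreal (\<lambda>s. s i / (1 - s DIM('a)))" for i
    by (intro continuous_map_real_divide continuous_map_diff proj) auto
  then have "continuous_map ?X (euclidean :: 'a topology) (\<lambda>s. (s i / (1 - s DIM('a))) *\<^sub>R basis_enum i)" for i
    using continuous_map_compose[of ?X euclideanreal "\<lambda>s. s i / (1 - s DIM('a))" euclidean "\<lambda>c. c *\<^sub>R (basis_enum i :: 'a)"]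
    by (simp add: o_def continuous_on_scaleR)
  then show ?thesis
    unfolding from_sphere_def[abs_def]
    by (intro continuous_map_sum) auto
qed

text \<open>Two gluings have to be continuous. At the frontier, values of norm at least 1 go to the
  pole, which is also the value outside \<open>\<Omega>\<close>. At the pole, where the chart breaks
  down, the map is locally constant because \<open>\<Omega>\<close> is bounded.\<close>

lemma homotopic_with_sphere_collapse:
  fixes h :: "real \<Rightarrow> 'a::euclidean_space \<Rightarrow> 'a"
  assumes \<Omega>: "open \<Omega>" "bounded \<Omega>"
    and cont: "continuous_on ({0..1} \<times> closure \<Omega>) (\<lambda>(t, x). h t x)"
    and front: "\<And>t x. t \<in> {0..1} \<Longrightarrow> x \<in> frontier \<Omega> \<Longrightarrow> norm (h t x) \<ge> 1"
  shows "homotopic_with (\<lambda>_. True) (nsphere DIM('a)) (nsphere DIM('a))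
           (sphere_collapse (h 0) \<Omega>) (sphere_collapse (h 1) \<Omega>)"
proof -
  let ?n = "DIM('a)" and ?N = "north_pole TYPE('a)"
  let ?I = "top_of_set {0..1::real}"
  let ?Y = "subtopology (nsphere ?n) (- {?N})"
  \<comment> \<open>The homotopy seen in the flat chart. It is glued from the closed sets
    \<open>closure \<Omega>\<close> and \<open>- \<Omega>\<close>, which overlap in the
    frontier.\<close>
  define G where "G t x = (if x \<in> \<Omega> then radial (h t x) else ?N)" for t x
  have G: "continuous_on ({0..1} \<times> UNIV) (\<lambda>(t, x). G t x i)" for i
  proof -
    have "continuous_on ({0..1} \<times> closure \<Omega> \<union> {0..1} \<times> (- \<Omega>))
        (\<lambda>z. if snd z \<in> \<Omega> then radial (h (fst z) (snd z)) i else ?N i)"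
    proof (rule continuous_on_cases)
      show "closed ({0..1::real} \<times> closure \<Omega>)" "closed ({0..1::real} \<times> (- \<Omega>))"
        using \<Omega> by (auto intro!: closed_Times)
      show "continuous_on ({0..1} \<times> closure \<Omega>) (\<lambda>z. radial (h (fst z) (snd z)) i)"
        using cont by (intro continuous_on_radial) (simp add: case_prod_unfold)
      show "\<forall>z. z \<in> {0..1} \<times> closure \<Omega> \<and> snd z \<notin> \<Omega> \<or> z \<in> {0..1} \<times> (- \<Omega>) \<and> snd z \<in> \<Omega> \<longrightarrow>
         radial (h (fst z) (snd z)) i = ?N i"
      proof (intro allI impI)
        fix z :: "real \<times> 'a"
        assume "z \<in> {0..1} \<times> closure \<Omega> \<and> snd z \<notin> \<Omega> \<or> z \<in> {0..1} \<times> (- \<Omega>) \<and> snd z \<in> \<Omega>"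
        then have "fst z \<in> {0..1}" "snd z \<in> frontier \<Omega>"
          using \<Omega> by (auto simp: frontier_def interior_open)
        then show "radial (h (fst z) (snd z)) i = ?N i"
          using front by (fastforce simp: radial_def)
      qed
    qed (auto intro: continuous_intros)
    moreover have "{0..1} \<times> closure \<Omega> \<union> {0..1} \<times> (- \<Omega>) = {0..1::real} \<times> UNIV"
      using closure_subset by auto
    ultimately show ?thesis
      by (auto simp: G_def case_prod_unfold if_distrib cong: if_cong elim!: continuous_on_cong[THEN iffD1, rotated 2])
  qed
  obtain B where B: "\<And>x. x \<in> \<Omega> \<Longrightarrow> norm x \<le> B"
    using \<Omega> by (auto simp: bounded_iff)
  \<comment> \<open>\<open>U\<close> is a neighbourhood of the pole on which
    \<open>from_sphere\<close> has left \<open>\<Omega>\<close>, so the map is constant there. On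
    \<open>V\<close>, the complement of the pole, the chart is continuous. Together they cover the
    product.\<close>
  define U where "U = {z \<in> topspace (prod_topology ?I (nsphere ?n)). snd z ?n \<in> {1 - 1 / (B\<^sup>2 + 1)<..}}"
  define V where "V = topspace ?I \<times> topspace ?Y"
  let ?P = "prod_topology ?I (nsphere ?n)"
  have oU: "openin ?P U"
    unfolding U_def
    by (rule openin_continuous_map_preimage[where Y=euclideanreal])
      (auto intro!: continuous_map_compose[OF continuous_map_snd continuous_map_nsphere_projection, unfolded o_def])
  have oV: "openin ?P V"
  proof -
    have "openin (nsphere ?n) (topspace ?Y)"
    proof -
      \<comment> \<open>Removing the pole amounts to the open condition that the last coordinate
        differs from 1.\<close>
      have "topspace ?Y = {s \<in> topspace (nsphere ?n). s ?n \<in> - {1}}"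
        using sphere_last_coord[where 'a='a] by (fastforce simp: north_pole_def)
      then show ?thesis
        using openin_continuous_map_preimage[OF continuous_map_nsphere_projection, of "- {1}" ?n ?n]
        by (simp add: open_Compl)
    qed
    then show ?thesis
      by (auto simp: V_def openin_prod_Times_iff)
  qed
  let ?H = "\<lambda>z. sphere_collapse (h (fst z)) \<Omega> (snd z)"
  have HG: "?H z = G (fst z) (from_sphere (snd z))" if "snd z \<noteq> ?N" for z
    using that by (auto simp: sphere_collapse_def G_def)
  have img: "sphere_collapse k \<Omega> s \<in> topspace (nsphere ?n)" for k s
    by (simp add: sphere_collapse_def radial_in_nsphere north_pole_in_nsphere del: topspace_subtopology)
  have coord: "continuous_map ?P euclideanreal (\<lambda>z. ?H z i)" for i
  proof (rule pasting_lemma[where I = "UNIV :: bool set" and T = "\<lambda>b. if b then U else V" and f = "\<lambda>_ z. ?H z i"])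
    show "openin ?P (if b then U else V)" for b
      using oU oV by auto
    have HU: "?H z = ?N" if "z \<in> U" for z
    proof (cases "snd z = ?N")
      case False
      have "norm (from_sphere (snd z) :: 'a) > B"
        using sphere_near_north_pole[OF _ False, of B] that by (auto simp: U_def)
      then show ?thesis
        using B by (force simp: sphere_collapse_def)
    qed (simp add: sphere_collapse_def)
    have "continuous_map (subtopology ?P U) euclideanreal (\<lambda>z. ?H z i)"
      by (rule continuous_map_eq[of _ _ "\<lambda>_. ?N i"]) (auto simp: HU)
    moreover have "continuous_map (subtopology ?P V) euclideanreal (\<lambda>z. ?H z i)"
    proof (rule continuous_map_eq)
      have V: "subtopology ?P V = prod_topology ?I ?Y"
        unfolding V_def subtopology_Times
        by (metis subtopology_restrict subtopology_topspace topspace_subtopology)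
      have chart: "continuous_map (prod_topology ?I ?Y) (prod_topology ?I euclidean) (\<lambda>z. (fst z, from_sphere (snd z) :: 'a))"
        by (intro continuous_map_pairedI continuous_map_fst
              continuous_map_compose[OF continuous_map_snd continuous_map_from_sphere, unfolded o_def])
      have "continuous_map (prod_topology ?I (euclidean :: 'a topology)) euclideanreal (\<lambda>(t, x). G t x i)"
        using G[of i] prod_topology_subtopology_eu[of "{0..1::real}" "UNIV :: 'a set"]
        by (simp only: subtopology_UNIV continuous_map_iff_continuous)
      from continuous_map_compose[OF chart this]
      show "continuous_map (subtopology ?P V) euclideanreal (\<lambda>z. G (fst z) (from_sphere (snd z)) i)"
        unfolding V by (simp only: o_def case_prod_conv)
      show "G (fst z) (from_sphere (snd z)) i = ?H z i" if "z \<in> topspace (subtopology ?P V)" for z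
        using that by (subst HG) (auto simp: V_def)
    qed
    ultimately show "continuous_map (subtopology ?P (if b then U else V)) euclideanreal (\<lambda>z. ?H z i)" for b
      by auto
    show "\<exists>j. j \<in> UNIV \<and> z \<in> (if j then U else V) \<and> ?H z i = ?H z i" if "z \<in> topspace ?P" for z
    proof (cases "snd z = ?N")
      case True
      then have "z \<in> U"
        using that by (auto simp: U_def north_pole_def add_nonneg_pos)
      then show ?thesis
        by (intro exI[of _ True]) auto
    next
      case False
      then have "z \<in> V"
        using that by (auto simp: V_def)
      then show ?thesis
        by (intro exI[of _ False]) auto
    qed
  qed auto
  have "continuous_map ?P (nsphere ?n) ?H"
    using coord img unfolding nsphere
    by (auto simp: continuous_map_in_subtopology continuous_map_componentwise_UNIV)
  then show ?thesis
    unfolding homotopic_with_def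
    by (intro exI[of _ ?H]) auto
qed

section \<open>Invariance and vanishing of the degree\<close>

lemma Brouwer_degree2_sphere_collapse:
  fixes h :: "real \<Rightarrow> 'a::euclidean_space \<Rightarrow> 'a"
  assumes "open \<Omega>" "bounded \<Omega>"
    and "continuous_on ({0..1} \<times> closure \<Omega>) (\<lambda>(t, x). h t x)"
    and "\<And>t x. t \<in> {0..1} \<Longrightarrow> x \<in> frontier \<Omega> \<Longrightarrow> norm (h t x) \<ge> 1"
  shows "Brouwer_degree2 DIM('a) (sphere_collapse (h 0) \<Omega>) = Brouwer_degree2 DIM('a) (sphere_collapse (h 1) \<Omega>)"
  using homotopic_with_sphere_collapse[OF assms] by (rule Brouwer_degree2_homotopic)

text \<open>The degree is first moved to a neighbourhood of level \<open>\<rho>\<close> so small that the collapse map does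
  not see the difference between \<open>\<Omega>\<close> and a large ball \<open>W\<close> (excision); on \<open>W\<close> the homotopy can be
  applied and ends at a constant map.\<close>

lemma brouwer_degree_eq_0:
  fixes H :: "real \<Rightarrow> 'a::euclidean_space \<Rightarrow> 'a"
  assumes cont: "continuous_on ({0..1} \<times> UNIV) (\<lambda>(t, x). H t x)"
    and \<Omega>: "open \<Omega>" "bounded \<Omega>" "\<Omega> \<noteq> {}"
    and start: "\<And>x. x \<notin> \<Omega> \<Longrightarrow> H 0 x \<noteq> 0"
    and far: "\<And>t x. t \<in> {0..1} \<Longrightarrow> norm x \<ge> R \<Longrightarrow> H t x \<noteq> 0"
    and stop: "\<And>x. H 1 x \<noteq> 0"
  shows "brouwer_degree (H 0) \<Omega> 0 = 0"
proof -
  obtain B where B: "\<And>x. x \<in> \<Omega> \<Longrightarrow> norm x \<le> B"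
    using \<Omega> by (auto simp: bounded_iff)
  \<comment> \<open>The radius exceeds the norms of all points of \<open>\<Omega>\<close>, so that
    \<open>W\<close> contains \<open>\<Omega>\<close>, and it is at least \<open>R\<close>, so that
    no zero lies on the boundary of \<open>W\<close>.\<close>
  define R' where "R' = max R (max B 0 + 1)"
  define W where "W = ball (0 :: 'a) R'"
  have R': "R' \<ge> R" "R' > 0" "\<Omega> \<subseteq> W"
    using B by (fastforce simp: R'_def W_def)+
  have frW: "frontier W = sphere 0 R'" and clW: "closure W = cball 0 R'"
    using R' by (auto simp: W_def)
  \<comment> \<open>The three places where zeros are excluded: the boundary of \<open>W\<close> at
    all times by \<open>far\<close>, the rest of \<open>W\<close> outside \<open>\<Omega>\<close> at
    time 0 by \<open>start\<close>, and all of \<open>W\<close> at time 1 by \<open>stop\<close>.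
    Compactness turns this into one positive lower bound \<open>\<rho>\<close>.\<close>
  define Z where "Z = {0..1} \<times> sphere 0 R' \<union> {0} \<times> (cball 0 R' - \<Omega>) \<union> {1::real} \<times> cball (0 :: 'a) R'"
  have "compact Z"
    unfolding Z_def using \<Omega> by (intro compact_Un compact_Times compact_diff) auto
  moreover have "(1, 0) \<in> Z"
    using R' by (simp add: Z_def)
  moreover have "continuous_on Z (\<lambda>(t, x). norm (H t x))"
    using cont unfolding case_prod_unfold
    by (intro continuous_on_norm) (auto simp: Z_def elim!: continuous_on_subset)
  ultimately obtain z where z: "z \<in> Z" "\<And>w. w \<in> Z \<Longrightarrow> norm (H (fst z) (snd z)) \<le> norm (H (fst w) (snd w))"
    using continuous_attains_inf[of Z "\<lambda>(t, x). norm (H t x)"] unfolding case_prod_unfold by blast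
  define \<rho> where "\<rho> = norm (H (fst z) (snd z))"
  have "H (fst z) (snd z) \<noteq> 0"
    using z(1) start far stop R' by (auto simp: Z_def)
  then have \<rho>: "\<rho> > 0" "\<And>t x. (t, x) \<in> Z \<Longrightarrow> \<rho> \<le> norm (H t x)"
    using z(2) by (auto simp: \<rho>_def)
  have \<rho>_frontier: "norm (H 0 x) \<ge> \<rho>" if "x \<in> frontier \<Omega>" for x
  proof -
    have "x \<in> closure W" "x \<notin> \<Omega>"
      using that R' closure_mono[of \<Omega> W] \<Omega> by (auto simp: frontier_def interior_open)
    then show ?thesis
      using \<rho>(2)[of 0 x] by (auto simp: Z_def clW)
  qed
  define r where "r = infdist 0 (H 0 ` frontier \<Omega>)"
  have cont0: "continuous_on S (H 0)" for S
  proof -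
    have "continuous_on S (\<lambda>x. (0 :: real, x))"
      by (intro continuous_intros)
    from continuous_on_compose2[OF cont this] show ?thesis
      by (simp add: image_subset_iff)
  qed
  \<comment> \<open>A nonempty bounded open set is not the whole space, so its frontier is nonempty.
    The distance to an empty image would be 0 by convention and could not serve as a level.\<close>
  have "frontier \<Omega> \<noteq> {}"
    using \<Omega> not_bounded_UNIV by (auto simp: frontier_eq_empty)
  moreover have "closed (H 0 ` frontier \<Omega>)"
    using \<Omega> by (intro compact_imp_closed compact_continuous_image cont0) (simp add: compact_frontier_bounded)
  moreover have "0 \<notin> H 0 ` frontier \<Omega>"
    using \<rho>_frontier \<rho>(1) by force
  ultimately have r: "r > 0"
    by (auto simp: r_def intro: infdist_pos_not_in_closed)
  have r_frontier: "norm (H 0 x) \<ge> r" if "x \<in> frontier \<Omega>" for x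
    using infdist_le[of "H 0 x" "H 0 ` frontier \<Omega>" 0] that by (simp add: r_def)
  have "brouwer_degree (H 0) \<Omega> 0 = Brouwer_degree2 DIM('a) (sphere_collapse (\<lambda>x. H 0 x /\<^sub>R r) \<Omega>)"
    unfolding brouwer_degree_def using collapse_map_eq_sphere_collapse[OF r_def r] by simp
  also have "\<dots> = Brouwer_degree2 DIM('a) (sphere_collapse (\<lambda>x. H 0 x /\<^sub>R \<rho>) \<Omega>)"
  proof -
    \<comment> \<open>A straight path between the levels. Both ends are positive and bound
      \<open>norm (H 0 x)\<close> from below on the frontier, and convex combinations inherit
      this.\<close>
    define c where "c t = (1 - t) * r + t * \<rho>" for t :: real
    have c: "c t > 0" if "t \<in> {0..1}" for t
      using that r \<rho>(1) by (cases "t = 0") (auto simp: c_def intro!: add_nonneg_pos)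
    have "continuous_on ({0..1} \<times> closure \<Omega>) (\<lambda>z. H 0 (snd z) /\<^sub>R c (fst z))"
    proof (intro continuous_intros)
      show "continuous_on ({0..1} \<times> closure \<Omega>) (\<lambda>z. H 0 (snd z))"
        by (rule continuous_on_compose2[OF cont0[of UNIV]]) (auto intro: continuous_intros)
      show "continuous_on ({0..1} \<times> closure \<Omega>) (\<lambda>z. c (fst z))"
        unfolding c_def by (intro continuous_intros)
      show "\<forall>z\<in>{0..1} \<times> closure \<Omega>. c (fst z) \<noteq> 0"
        using c by fastforce
    qed
    moreover have "norm (H 0 x /\<^sub>R c t) \<ge> 1" if "t \<in> {0..1}" "x \<in> frontier \<Omega>" for t x
    proof -
      have "c t \<le> norm (H 0 x)"
        using convex_bound_le[of r "norm (H 0 x)" \<rho> "1 - t" t] r_frontier \<rho>_frontier that by (simp add: c_def)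
      then show ?thesis
        using c[OF that(1)] by (simp add: field_simps)
    qed
    ultimately show ?thesis
      using Brouwer_degree2_sphere_collapse[OF \<Omega>(1,2), of "\<lambda>t x. H 0 x /\<^sub>R c t"]
      by (simp add: c_def case_prod_unfold)
  qed
  also have "sphere_collapse (\<lambda>x. H 0 x /\<^sub>R \<rho>) \<Omega> = sphere_collapse (\<lambda>x. H 0 x /\<^sub>R \<rho>) W"
  proof
    fix s
    have "norm (H 0 x) \<ge> \<rho>" if "x \<in> W" "x \<notin> \<Omega>" for x
      using that \<rho>(2)[of 0 x] by (auto simp: Z_def W_def)
    then have "radial (H 0 x /\<^sub>R \<rho>) = north_pole TYPE('a)" if "x \<in> W" "x \<notin> \<Omega>" for x
      using that \<rho>(1) by (intro radial_far) auto
    then show "sphere_collapse (\<lambda>x. H 0 x /\<^sub>R \<rho>) \<Omega> s = sphere_collapse (\<lambda>x. H 0 x /\<^sub>R \<rho>) W s"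
      using R' by (auto simp: sphere_collapse_def)
  qed
  also have "Brouwer_degree2 DIM('a) (sphere_collapse (\<lambda>x. H 0 x /\<^sub>R \<rho>) W)
      = Brouwer_degree2 DIM('a) (sphere_collapse (\<lambda>x. H 1 x /\<^sub>R \<rho>) W)"
  proof (rule Brouwer_degree2_sphere_collapse[where h = "\<lambda>t x. H t x /\<^sub>R \<rho>"])
    show "continuous_on ({0..1} \<times> closure W) (\<lambda>(t, x). H t x /\<^sub>R \<rho>)"
      using continuous_on_subset[OF cont, of "{0..1} \<times> closure W"]
      by (auto simp: case_prod_unfold intro!: continuous_intros)
    show "1 \<le> norm (H t x /\<^sub>R \<rho>)" if "t \<in> {0..1}" "x \<in> frontier W" for t x
      using \<rho>(1) \<rho>(2)[of t x] that by (simp add: Z_def frW field_simps)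
  qed (auto simp: W_def)
  also have "sphere_collapse (\<lambda>x. H 1 x /\<^sub>R \<rho>) W = (\<lambda>_. north_pole TYPE('a))"
  proof
    fix s
    have "norm (H 1 x) \<ge> \<rho>" if "x \<in> W" for x
      using that \<rho>(2)[of 1 x] by (auto simp: Z_def W_def)
    then have "radial (H 1 x /\<^sub>R \<rho>) = north_pole TYPE('a)" if "x \<in> W" for x
      using that \<rho>(1) by (intro radial_far) auto
    then show "sphere_collapse (\<lambda>x. H 1 x /\<^sub>R \<rho>) W s = north_pole TYPE('a)"
      by (auto simp: sphere_collapse_def)
  qed
  finally show ?thesis
    by (simp add: Brouwer_degree2_const)
qed

text \<open>By contraposition: without a zero at time 1, the degree vanishes on every bounded open
  neighbourhood of \<open>z\<close>, and hence so does the index.\<close>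

lemma brouwer_index_homotopy_zero:
  fixes H :: "real \<Rightarrow> 'a::euclidean_space \<Rightarrow> 'a"
  assumes cont: "continuous_on ({0..1} \<times> UNIV) (\<lambda>(t, x). H t x)"
    and start: "\<And>x. H 0 x = 0 \<longleftrightarrow> x = z"
    and far: "\<And>t x. t \<in> {0..1} \<Longrightarrow> norm x \<ge> R \<Longrightarrow> H t x \<noteq> 0"
    and index: "brouwer_index (H 0) z \<noteq> 0"
  obtains x where "H 1 x = 0"
proof -
  have "\<exists>x. H 1 x = 0"
  proof (rule ccontr)
    assume "\<nexists>x. H 1 x = 0"
    then have *: "brouwer_degree (H 0) \<Omega> 0 = 0" if "open \<Omega>" "bounded \<Omega>" "z \<in> \<Omega>" for \<Omega>
      using that by (intro brouwer_degree_eq_0[OF cont _ _ _ _ far]) (auto simp: start)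
    \<comment> \<open>One concrete admissible neighbourhood is required, since the definite
      description in the index would otherwise be met by every value.\<close>
    have zeros: "{x \<in> closure (ball z 1). H 0 x = 0} = {z}"
      using centre_in_ball[of z 1] closure_subset[of "ball z 1"] by (auto simp: start)
    have "brouwer_index (H 0) z = 0"
      unfolding brouwer_index_def
    proof (rule the_equality)
      show "\<forall>\<Omega>. open \<Omega> \<and> bounded \<Omega> \<and> z \<in> \<Omega> \<and> {x \<in> closure \<Omega>. H 0 x = 0} = {z} \<longrightarrow> brouwer_degree (H 0) \<Omega> 0 = 0"
        using * by blast
    next
      fix d
      assume "\<forall>\<Omega>. open \<Omega> \<and> bounded \<Omega> \<and> z \<in> \<Omega> \<and> {x \<in> closure \<Omega>. H 0 x = 0} = {z} \<longrightarrow> brouwer_degree (H 0) \<Omega> 0 = d"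
      then have "brouwer_degree (H 0) (ball z 1) 0 = d"
        using zeros by simp
      then show "d = 0"
        using *[of "ball z 1"] by simp
    qed
    then show False
      using index by simp
  qed
  then show ?thesis
    using that by blast
qed

section \<open>Recession cones and projections\<close>

lemma recession_coneI:
  assumes "filterlim t at_top sequentially" "\<And>k. x k \<in> K" "(\<lambda>k. x k /\<^sub>R t k) \<longlonglongrightarrow> u"
  shows "u \<in> recession_cone K"
  using assms unfolding recession_cone_def by blast

lemma recession_cone_scaleR:
  assumes "u \<in> recession_cone K" "c > 0"
  shows "c *\<^sub>R u \<in> recession_cone K"
proof -
  obtain t x where tx: "filterlim t at_top sequentially" "\<And>k. x k \<in> K" "(\<lambda>k. x k /\<^sub>R t k) \<longlonglongrightarrow> u"
    using assms by (auto simp: recession_cone_def)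
  have "filterlim (\<lambda>k. inverse c * t k) at_top sequentially"
    using tx(1) assms(2) by (intro filterlim_tendsto_pos_mult_at_top[OF tendsto_const]) auto
  moreover have "(\<lambda>k. x k /\<^sub>R (inverse c * t k)) \<longlonglongrightarrow> c *\<^sub>R u"
    using tendsto_scaleR[OF tendsto_const[of c] tx(3)] by simp
  ultimately show ?thesis
    using tx(2) recession_coneI by metis
qed

text \<open>If \<open>z k /\<^sub>R t k\<close> tends to \<open>u\<close>, the convex combinations
  of \<open>x\<close> and \<open>z k\<close> with weight \<open>inverse (t k)\<close> on
  \<open>z k\<close> eventually lie in \<open>K\<close> and tend to \<open>x + u\<close>.\<close>

lemma add_recession_cone:
  assumes K: "closed K" "convex K" and x: "x \<in> K" and u: "u \<in> recession_cone K"
  shows "x + u \<in> K"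
proof -
  obtain t z where tz: "filterlim t at_top sequentially" "\<And>k. z k \<in> K" "(\<lambda>k. z k /\<^sub>R t k) \<longlonglongrightarrow> u"
    using u by (auto simp: recession_cone_def)
  have "(\<lambda>k. inverse (t k)) \<longlonglongrightarrow> 0"
    using tz(1) by (rule tendsto_inverse_0_at_top)
  then have "(\<lambda>k. (1 - inverse (t k)) *\<^sub>R x + inverse (t k) *\<^sub>R z k) \<longlonglongrightarrow> (1 - 0) *\<^sub>R x + u"
    using tz(3) by (intro tendsto_intros)
  moreover have "\<forall>\<^sub>F k in sequentially. (1 - inverse (t k)) *\<^sub>R x + inverse (t k) *\<^sub>R z k \<in> K"
  proof -
    have "\<forall>\<^sub>F k in sequentially. t k \<ge> 1"
      using tz(1) by (simp add: filterlim_at_top)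
    then show ?thesis
    proof eventually_elim
      case (elim k)
      then have "inverse (t k) \<in> {0..1}"
        by (simp add: field_simps)
      then show ?case
        using K(2) x tz(2)[of k] by (intro convexD) auto
    qed
  qed
  ultimately show ?thesis
    using Lim_in_closed_set[OF K(1)] by fastforce
qed

text \<open>For the converse inclusion, a point \<open>a\<close> of \<open>K\<close> is moved
  repeatedly by \<open>u\<close>, and the points \<open>a + n u\<close> divided by \<open>n\<close>
  tend to \<open>u\<close>. In this form closedness and additivity become immediate.\<close>

lemma recession_cone_eq:
  assumes K: "K \<noteq> {}" "closed K" "convex K"
  shows "recession_cone K = {u. \<forall>x\<in>K. x + u \<in> K}"
proof (intro equalityI subsetI)
  fix u
  assume "u \<in> {u. \<forall>x\<in>K. x + u \<in> K}"
  then have u: "\<And>x. x \<in> K \<Longrightarrow> x + u \<in> K"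
    by auto
  obtain a where a: "a \<in> K"
    using K by auto
  have mem: "a + real n *\<^sub>R u \<in> K" for n
  proof (induction n)
    case (Suc n)
    then show ?case
      using u[OF Suc] by (simp add: algebra_simps)
  qed (use a in simp)
  have lim: "(\<lambda>n. inverse (real (Suc n)) *\<^sub>R a + u) \<longlonglongrightarrow> 0 *\<^sub>R a + u"
    by (intro tendsto_intros LIMSEQ_inverse_real_of_nat)
  have "(a + real (Suc n) *\<^sub>R u) /\<^sub>R real (Suc n) = inverse (real (Suc n)) *\<^sub>R a + u" for n
    by (simp add: scaleR_add_right del: of_nat_Suc)
  then have "(\<lambda>n. (a + real (Suc n) *\<^sub>R u) /\<^sub>R real (Suc n)) \<longlonglongrightarrow> u"
    using lim by simp
  moreover have "filterlim (\<lambda>n. real (Suc n)) at_top sequentially"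
    using filterlim_real_sequentially filterlim_sequentially_Suc by blast
  ultimately show "u \<in> recession_cone K"
    using mem by (intro recession_coneI[of "\<lambda>n. real (Suc n)"])
qed (use add_recession_cone[OF K(2,3)] in auto)

lemma zero_in_recession_cone:
  "\<lbrakk>K \<noteq> {}; closed K; convex K\<rbrakk> \<Longrightarrow> 0 \<in> recession_cone K"
  by (simp add: recession_cone_eq)

lemma add_in_recession_cone:
  assumes K: "K \<noteq> {}" "closed K" "convex K" and "u \<in> recession_cone K" "v \<in> recession_cone K"
  shows "u + v \<in> recession_cone K"
  using assms(4,5) by (simp add: recession_cone_eq[OF K] flip: add.assoc)

lemma closed_recession_cone:
  fixes K :: "'a::real_normed_vector set"
  assumes K: "K \<noteq> {}" "closed K" "convex K"
  shows "closed (recession_cone K)"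
proof -
  have "recession_cone K = (\<Inter>x\<in>K. (\<lambda>u. x + u) -` K)"
    by (auto simp: recession_cone_eq[OF K])
  moreover have "closed ((\<lambda>u. x + u) -` K)" for x
    using K(2) by (intro closed_vimage) (auto intro: continuous_intros)
  ultimately show ?thesis
    by auto
qed

lemma convex_recession_cone:
  assumes K: "K \<noteq> {}" "closed K" "convex K"
  shows "convex (recession_cone K)"
proof (rule convexI)
  fix x y and u v :: real
  assume xy: "x \<in> recession_cone K" "y \<in> recession_cone K" and uv: "0 \<le> u" "0 \<le> v"
  have "c *\<^sub>R z \<in> recession_cone K" if "c \<ge> 0" "z \<in> recession_cone K" for c z
    using that zero_in_recession_cone[OF K] recession_cone_scaleR[of z K c] by (cases "c = 0") auto
  then show "u *\<^sub>R x + v *\<^sub>R y \<in> recession_cone K"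
    using xy uv by (intro add_in_recession_cone[OF K]) auto
qed

lemma recession_cone_subset:
  assumes "K \<subseteq> C" "closed C" "Convex.cone C"
  shows "recession_cone K \<subseteq> C"
proof
  fix u
  assume "u \<in> recession_cone K"
  then obtain t x where tx: "filterlim t at_top sequentially" "\<And>k. x k \<in> K" "(\<lambda>k. x k /\<^sub>R t k) \<longlonglongrightarrow> u"
    by (auto simp: recession_cone_def)
  have "\<forall>\<^sub>F k in sequentially. t k \<ge> 0"
    using tx(1) by (simp add: filterlim_at_top)
  then have "\<forall>\<^sub>F k in sequentially. x k /\<^sub>R t k \<in> C"
    by eventually_elim (use assms tx(2) in \<open>auto simp: Convex.cone_def subset_iff\<close>)
  then show "u \<in> C"
    using Lim_in_closed_set[OF assms(2) _ _ tx(3)] by auto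
qed

text \<open>The cone contains 0 and is closed under addition. Hence the conditions on the leading
  terms and on the index stay the same when \<open>K\<close> is replaced by its recession
  cone.\<close>

lemma recession_cone_idem:
  assumes K: "K \<noteq> {}" "closed K" "convex K"
  shows "recession_cone (recession_cone K) = recession_cone K"
proof -
  have "recession_cone (recession_cone K) = {u. \<forall>x\<in>recession_cone K. x + u \<in> recession_cone K}"
    using zero_in_recession_cone[OF K]
    by (intro recession_cone_eq closed_recession_cone[OF K] convex_recession_cone[OF K]) auto
  then show ?thesis
    using zero_in_recession_cone[OF K] by (force intro: add_in_recession_cone[OF K])
qed

section \<open>Natural maps, variational inequalities and complementarity\<close>

text \<open>A zero means that \<open>\<psi> x\<close> is the projection of
  \<open>\<psi> x - \<phi> x\<close>, and the obtuse angle criterion for projections is the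
  variational inequality. Conversely, the inequality makes the cross term nonnegative when the
  squared distance to a competitor \<open>z\<close> is expanded.\<close>

lemma natural_map_eq_0_iff:
  assumes S: "closed S" "convex S" "S \<noteq> {}"
  shows "natural_map \<phi> \<psi> S x = 0 \<longleftrightarrow> \<psi> x \<in> S \<and> (\<forall>y\<in>S. 0 \<le> \<phi> x \<bullet> (y - \<psi> x))"
proof
  assume "natural_map \<phi> \<psi> S x = 0"
  then have eq: "closest_point S (\<psi> x - \<phi> x) = \<psi> x"
    by (simp add: natural_map_def)
  then have "\<psi> x \<in> S"
    using closest_point_in_set[OF S(1,3)] by metis
  moreover have "0 \<le> \<phi> x \<bullet> (y - \<psi> x)" if "y \<in> S" for y
    using closest_point_dot[OF S(2,1) that, of "\<psi> x - \<phi> x"] by (simp add: eq)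
  ultimately show "\<psi> x \<in> S \<and> (\<forall>y\<in>S. 0 \<le> \<phi> x \<bullet> (y - \<psi> x))"
    by blast
next
  assume *: "\<psi> x \<in> S \<and> (\<forall>y\<in>S. 0 \<le> \<phi> x \<bullet> (y - \<psi> x))"
  have "dist (\<psi> x - \<phi> x) (\<psi> x) \<le> dist (\<psi> x - \<phi> x) z" if "z \<in> S" for z
  proof -
    have "(norm (\<phi> x))\<^sup>2 \<le> (norm (\<phi> x))\<^sup>2 + 2 * (\<phi> x \<bullet> (z - \<psi> x)) + (norm (z - \<psi> x))\<^sup>2"
      using * that by simp
    also have "\<dots> = (norm (\<phi> x + (z - \<psi> x)))\<^sup>2"
      by (simp add: power2_norm_eq_inner inner_add_left inner_add_right inner_commute)
    finally have "norm (\<phi> x) \<le> norm (\<phi> x + (z - \<psi> x))"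
      by (rule power2_le_imp_le) simp
    also have "\<phi> x + (z - \<psi> x) = - ((\<psi> x - \<phi> x) - z)"
      by simp
    finally show ?thesis
      by (simp only: dist_norm norm_minus_cancel) simp
  qed
  then have "\<psi> x = closest_point S (\<psi> x - \<phi> x)"
    using * by (intro closest_point_unique S) auto
  then show "natural_map \<phi> \<psi> S x = 0"
    by (simp add: natural_map_def)
qed

text \<open>Testing the inequality at \<open>0\<close> and at \<open>2 *\<^sub>R \<psi> x\<close>
  gives both signs of \<open>\<phi> x \<bullet> \<psi> x\<close>, which is therefore 0.\<close>

lemma GCP_solutions_eq_SOL:
  assumes "0 \<in> S" and scale: "\<And>x c. x \<in> S \<Longrightarrow> c > 0 \<Longrightarrow> c *\<^sub>R x \<in> S"
  shows "GCP_solutions D \<phi> \<psi> S = SOL D \<phi> \<psi> S"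
proof -
  have "\<phi> x \<bullet> \<psi> x = 0" if "\<psi> x \<in> S" "\<And>y. y \<in> S \<Longrightarrow> 0 \<le> \<phi> x \<bullet> (y - \<psi> x)" for x
    using that(2)[OF assms(1)] that(2)[OF scale[OF that(1), of 2]] by (simp add: inner_diff_right)
  then have "x \<in> SOL D \<phi> \<psi> S \<longleftrightarrow> x \<in> GCP_solutions D \<phi> \<psi> S" for x
    by (fastforce simp: SOL_def GCP_solutions_def dual_cone_def inner_diff_right)
  then show ?thesis
    by blast
qed

section \<open>The sets \<open>t K\<close> and their limit at \<open>t = 0\<close>\<close>

text \<open>The sets \<open>t K\<close> converge to the recession cone as \<open>t\<close> tends to 0 from above, which makes the
  projections onto them jointly continuous in \<open>t\<close> and the point, up to \<open>t = 0\<close>.\<close>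

definition recession_homotopy :: "'a::real_normed_vector set \<Rightarrow> real \<Rightarrow> 'a set" where
  "recession_homotopy K t = (if t = 0 then recession_cone K else (*\<^sub>R) t ` K)"

lemma recession_homotopy_closed_convex:
  assumes "K \<noteq> {}" "closed K" "convex K"
  shows "closed (recession_homotopy K t)" "convex (recession_homotopy K t)"
  using assms
  by (auto simp: recession_homotopy_def closed_scaling convex_scaling closed_recession_cone convex_recession_cone)

text \<open>For \<open>t > 0\<close> the point is \<open>t\<close> times
  \<open>a + y /\<^sub>R t\<close>, which lies in \<open>K\<close> because recession directions can
  be added. These explicit members serve as test points close to \<open>y\<close> when
  \<open>t\<close> is small.\<close>

lemma mem_recession_homotopy:
  assumes "y \<in> recession_cone K" "a \<in> K" "closed K" "convex K" "t \<ge> 0"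
  shows "y + t *\<^sub>R a \<in> recession_homotopy K t"
proof (cases "t = 0")
  case False
  then have "a + y /\<^sub>R t \<in> K"
    using assms by (intro add_recession_cone recession_cone_scaleR) auto
  moreover have "y + t *\<^sub>R a = t *\<^sub>R (a + y /\<^sub>R t)"
    using False by (simp add: scaleR_add_right)
  ultimately show ?thesis
    using False by (auto simp: recession_homotopy_def)
qed (use assms in \<open>simp add: recession_homotopy_def\<close>)

text \<open>By convexity, \<open>t K + r K\<close> lies in \<open>(t + r) K\<close>. A point can
  thus be lifted from level \<open>t\<close> to level \<open>t + r\<close> at the cost of the small
  correction \<open>r *\<^sub>R a\<close>.\<close>

lemma recession_homotopy_add:
  assumes "s \<in> recession_homotopy K t" "a \<in> K" "closed K" "convex K" "t \<ge> 0" "r \<ge> 0"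
  shows "s + r *\<^sub>R a \<in> recession_homotopy K (t + r)"
proof (cases "t = 0")
  case True
  then show ?thesis
    using assms by (auto simp: recession_homotopy_def[of K 0] intro: mem_recession_homotopy)
next
  case False
  then obtain x where x: "x \<in> K" "s = t *\<^sub>R x"
    using assms(1) by (auto simp: recession_homotopy_def)
  have pos: "t + r > 0"
    using False assms by simp
  have "(t / (t + r)) *\<^sub>R x + (r / (t + r)) *\<^sub>R a \<in> K"
    using pos assms x by (intro convexD) (auto simp: add_divide_distrib[symmetric])
  moreover have "s + r *\<^sub>R a = (t + r) *\<^sub>R ((t / (t + r)) *\<^sub>R x + (r / (t + r)) *\<^sub>R a)"
    using pos x by (simp add: scaleR_add_right)
  ultimately show ?thesis
    using pos by (auto simp: recession_homotopy_def)
qed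

lemma recession_homotopy_subset:
  assumes "K \<subseteq> C" "closed C" "Convex.cone C" "t \<ge> 0"
  shows "recession_homotopy K t \<subseteq> C"
  using assms recession_cone_subset[OF assms(1-3)]
  by (auto simp: recession_homotopy_def Convex.cone_def)

text \<open>Outer semicontinuity of the family. Dividing by the level gives points of
  \<open>K\<close>: if the levels tend to 0, their limit behaviour is that in the definition of the
  recession cone, and otherwise closedness of \<open>K\<close> applies.\<close>

lemma recession_homotopy_limit:
  fixes K :: "'a::real_normed_vector set"
  assumes K: "K \<noteq> {}" "closed K" "convex K"
    and t: "\<And>k. t k \<in> {0..1}" "t \<longlonglongrightarrow> \<tau>"
    and u: "\<And>k. u k \<in> recession_homotopy K (t k)" "u \<longlonglongrightarrow> v"
  shows "v \<in> recession_homotopy K \<tau>"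
proof -
  obtain a where a: "a \<in> K"
    using K by auto
  \<comment> \<open>perturb \<open>t k\<close> to be positive, so that both branches of the definition are treated alike\<close>
  define e where "e k = inverse (real (Suc k))" for k
  have e: "e k > 0" "e \<longlonglongrightarrow> 0" for k
    unfolding e_def by (simp, rule LIMSEQ_inverse_real_of_nat)
  have pos: "t k + e k > 0" for k
    using t(1)[of k] e(1)[of k] by simp
  have te: "(\<lambda>k. t k + e k) \<longlonglongrightarrow> \<tau>"
    using tendsto_add[OF t(2) e(2)] by simp
  have ue: "(\<lambda>k. u k + e k *\<^sub>R a) \<longlonglongrightarrow> v"
    using tendsto_add[OF u(2) tendsto_scaleR[OF e(2) tendsto_const]] by simp
  define w where "w k = (u k + e k *\<^sub>R a) /\<^sub>R (t k + e k)" for k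
  have w: "w k \<in> K" for k
  proof -
    have "u k + e k *\<^sub>R a \<in> recession_homotopy K (t k + e k)"
      using t(1)[of k] e(1)[of k] by (intro recession_homotopy_add u a K) auto
    then show ?thesis
      using pos[of k] by (auto simp: recession_homotopy_def w_def)
  qed
  have uw: "u k + e k *\<^sub>R a = (t k + e k) *\<^sub>R w k" for k
    using pos[of k] by (simp add: w_def)
  show ?thesis
  proof (cases "\<tau> = 0")
    case True
    have "filterlim (\<lambda>k. inverse (t k + e k)) at_top sequentially"
      using te True pos by (intro filterlim_inverse_at_top) auto
    moreover have "(\<lambda>k. w k /\<^sub>R inverse (t k + e k)) \<longlonglongrightarrow> v"
      using ue by (simp add: uw)
    ultimately have "v \<in> recession_cone K"
      using w by (intro recession_coneI)
    then show ?thesis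
      using True by (simp add: recession_homotopy_def)
  next
    case False
    have "w \<longlonglongrightarrow> v /\<^sub>R \<tau>"
      unfolding w_def using ue te False by (intro tendsto_intros)
    then have "v /\<^sub>R \<tau> \<in> K"
      using w K(2) closed_sequentially by blast
    then show ?thesis
      using False by (auto simp: recession_homotopy_def intro!: image_eqI[of _ _ "v /\<^sub>R \<tau>"])
  qed
qed

text \<open>Inner semicontinuity of the family, with explicit approximants:
  \<open>y + t k *\<^sub>R a\<close> if the limit level is 0, and \<open>t k *\<^sub>R x\<close> if
  \<open>y = \<tau> *\<^sub>R x\<close>.\<close>

lemma recession_homotopy_approx:
  assumes K: "K \<noteq> {}" "closed K" "convex K"
    and t: "\<And>k. t k \<in> {0..1}" "t \<longlonglongrightarrow> \<tau>" and y: "y \<in> recession_homotopy K \<tau>"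
  obtains s where "\<And>k. s k \<in> recession_homotopy K (t k)" "s \<longlonglongrightarrow> y"
proof (cases "\<tau> = 0")
  case True
  obtain a where a: "a \<in> K"
    using K by auto
  show ?thesis
  proof
    show "y + t k *\<^sub>R a \<in> recession_homotopy K (t k)" for k
      using True y t(1)[of k] by (intro mem_recession_homotopy a K) (auto simp: recession_homotopy_def)
    show "(\<lambda>k. y + t k *\<^sub>R a) \<longlonglongrightarrow> y"
      using tendsto_add[OF tendsto_const tendsto_scaleR[OF t(2) tendsto_const]] True by fastforce
  qed
next
  case False
  then obtain x where x: "x \<in> K" "y = \<tau> *\<^sub>R x"
    using y by (auto simp: recession_homotopy_def)
  show ?thesis
  proof
    show "t k *\<^sub>R x \<in> recession_homotopy K (t k)" for k
      using mem_recession_homotopy[of 0 K x "t k"] t(1)[of k] x K zero_in_recession_cone[OF K] by simp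
    show "(\<lambda>k. t k *\<^sub>R x) \<longlonglongrightarrow> y"
      using tendsto_scaleR[OF t(2) tendsto_const] x by simp
  qed
qed

text \<open>Over a bounded set of points the projections stay in a compact ball, so a closed graph
  suffices. Outer semicontinuity keeps limits of projections feasible, and inner semicontinuity
  supplies competitors that show them to be closest.\<close>

lemma continuous_on_closest_point_recession_homotopy:
  fixes K :: "'a::euclidean_space set"
  assumes K: "K \<noteq> {}" "closed K" "convex K"
  shows "continuous_on ({0..1} \<times> UNIV) (\<lambda>(t, z). closest_point (recession_homotopy K t) z)"
proof -
  let ?S = "recession_homotopy K"
  let ?P = "\<lambda>w. closest_point (?S (fst w)) (snd w)"
  obtain a where a: "a \<in> K"
    using K by auto
  have aS: "t *\<^sub>R a \<in> ?S t" if "t \<ge> 0" for t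
    using mem_recession_homotopy[OF zero_in_recession_cone[OF K] a K(2,3) that] by simp
  note S = recession_homotopy_closed_convex[OF K]
  have bounded: "continuous_on ({0..1} \<times> cball 0 B) ?P" for B
  proof (rule continuous_from_closed_graph)
    \<comment> \<open>The radius comes from comparing the projection of \<open>z\<close> with the
      feasible point \<open>t *\<^sub>R a\<close>: its distance from \<open>z\<close> is at most
      \<open>norm z + norm a\<close>.\<close>
    show "compact (cball (0 :: 'a) (2 * B + norm a))"
      by simp
    show "?P \<in> {0..1} \<times> cball 0 B \<rightarrow> cball 0 (2 * B + norm a)"
    proof
      fix w :: "real \<times> 'a"
      assume w: "w \<in> {0..1} \<times> cball 0 B"
      then have "dist (snd w) (?P w) \<le> dist (snd w) (fst w *\<^sub>R a)"
        by (intro closest_point_le S aS) auto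
      moreover have "norm (?P w) \<le> norm (snd w) + dist (snd w) (?P w)"
        using norm_triangle_sub[of "?P w" "snd w"] by (simp add: dist_norm norm_minus_commute)
      moreover have "dist (snd w) (fst w *\<^sub>R a) \<le> norm (snd w) + norm (fst w *\<^sub>R a)"
        unfolding dist_norm by (rule norm_triangle_ineq4)
      moreover have "norm (fst w *\<^sub>R a) \<le> norm a"
        using w mult_left_le_one_le[of "norm a" "\<bar>fst w\<bar>"] by auto
      ultimately show "?P w \<in> cball 0 (2 * B + norm a)"
        using w by auto
    qed
    show "closed ((\<lambda>w. (w, ?P w)) ` ({0..1} \<times> cball 0 B))"
      unfolding closed_sequential_limits
    proof (intro allI impI)
      fix X :: "nat \<Rightarrow> (real \<times> 'a) \<times> 'a" and l
      assume "(\<forall>n. X n \<in> (\<lambda>w. (w, ?P w)) ` ({0..1} \<times> cball 0 B)) \<and> X \<longlonglongrightarrow> l"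
      then have graph: "X n \<in> (\<lambda>w. (w, ?P w)) ` ({0..1} \<times> cball 0 B)" and "X \<longlonglongrightarrow> l" for n
        by blast+
      have X: "fst (X n) \<in> {0..1} \<times> cball 0 B" "snd (X n) = ?P (fst (X n))" for n
        using graph[of n] by (metis (no_types, lifting) fst_conv imageE, metis (no_types, lifting) fst_conv snd_conv imageE)
      define t where "t n = fst (fst (X n))" for n
      define z where "z n = snd (fst (X n))" for n
      define u where "u n = snd (X n)" for n
      have t: "t n \<in> {0..1}" "t \<longlonglongrightarrow> fst (fst l)" and z: "z \<longlonglongrightarrow> snd (fst l)" and u: "u \<longlonglongrightarrow> snd l" for n
        using X(1)[of n] \<open>X \<longlonglongrightarrow> l\<close> unfolding t_def z_def u_def by (auto intro!: tendsto_intros)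
      have uP: "u n = closest_point (?S (t n)) (z n)" for n
        unfolding t_def z_def u_def by (rule X(2))
      have ne: "?S (t n) \<noteq> {}" for n
        using aS[of "t n"] t(1)[of n] by auto
      have uS: "u n \<in> ?S (t n)" for n
        unfolding uP by (intro closest_point_in_set S ne)
      have fl: "fst l \<in> {0..1} \<times> cball 0 B"
        by (rule closed_sequentially[of _ "\<lambda>n. fst (X n)"])
          (use X(1) \<open>X \<longlonglongrightarrow> l\<close> in \<open>auto intro!: tendsto_intros closed_Times\<close>)
      have "snd l = ?P (fst l)"
      proof (intro closest_point_unique S ballI)
        show "snd l \<in> ?S (fst (fst l))"
          using recession_homotopy_limit[OF K t uS u] .
        fix y
        assume "y \<in> ?S (fst (fst l))"
        then obtain s where s: "\<And>k. s k \<in> ?S (t k)" "s \<longlonglongrightarrow> y"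
          using recession_homotopy_approx[OF K t] by blast
        have "dist (z n) (u n) \<le> dist (z n) (s n)" for n
          unfolding uP by (intro closest_point_le S s)
        then show "dist (snd (fst l)) (snd l) \<le> dist (snd (fst l)) y"
          by (intro LIMSEQ_le[OF tendsto_dist[OF z u] tendsto_dist[OF z s(2)]]) auto
      qed
      then show "l \<in> (\<lambda>w. (w, ?P w)) ` ({0..1} \<times> cball 0 B)"
        using fl by (intro image_eqI[of _ _ "fst l"]) (auto simp: prod_eq_iff)
    qed
  qed
  \<comment> \<open>A convergent sequence is bounded, so continuity on the whole space reduces to
    the bounded case.\<close>
  have "continuous_on ({0..1} \<times> UNIV) ?P"
    unfolding continuous_on_sequentially
  proof (intro allI ballI impI)
    fix X :: "nat \<Rightarrow> real \<times> 'a" and l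
    assume l: "l \<in> {0..1} \<times> UNIV" and X: "(\<forall>n. X n \<in> {0..1} \<times> UNIV) \<and> X \<longlonglongrightarrow> l"
    then have "Bseq X"
      using convergent_def convergent_imp_Bseq by blast
    then obtain B where B: "\<And>n. norm (X n) \<le> B"
      by (auto simp: Bseq_def)
    have "norm (snd (X n)) \<le> B" for n
      using norm_snd_le[of "snd (X n)" "fst (X n)"] B[of n] by simp
    then have XB: "X n \<in> {0..1} \<times> cball 0 (max B (norm (snd l)))" for n
      using X by (auto simp: mem_Times_iff max.coboundedI1)
    then show "(?P \<circ> X) \<longlonglongrightarrow> ?P l"
      using bounded[of "max B (norm (snd l))"] X l unfolding continuous_on_sequentially
      by (auto simp: mem_Times_iff)
  qed
  then show ?thesis
    by (simp add: case_prod_unfold)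
qed

section \<open>The homotopy of natural maps\<close>

text \<open>The convex combination equals \<open>\<phi>inf + t e\<close>. After division by
  \<open>norm x powr \<delta>\<close>, homogeneity turns the leading term into its value at the
  normalised point, and the remainder, weighted by a bounded factor, vanishes in the limit.\<close>

lemma weakly_homogeneous_limit:
  fixes \<phi> \<phi>inf :: "'a::euclidean_space \<Rightarrow> 'a"
  assumes \<phi>: "weakly_homogeneous_on D \<delta> \<phi> \<phi>inf"
    and D: "closed D" "Convex.cone D"
    and x: "\<And>k. x k \<in> D" "filterlim (\<lambda>k. norm (x k)) at_top sequentially" "(\<lambda>k. x k /\<^sub>R norm (x k)) \<longlonglongrightarrow> u"
    and t: "\<And>k. t k \<in> {0..1}"
  shows "(\<lambda>k. ((1 - t k) *\<^sub>R \<phi>inf (x k) + t k *\<^sub>R \<phi> (x k)) /\<^sub>R (norm (x k) powr \<delta>)) \<longlonglongrightarrow> \<phi>inf u"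
proof -
  obtain e where e: "\<And>x. x \<in> D \<Longrightarrow> \<phi> x = \<phi>inf x + e x"
      "filterlim (\<lambda>x. e x /\<^sub>R (norm x powr \<delta>)) (nhds 0) (inf at_infinity (principal D))"
    and cont: "continuous_on D \<phi>inf"
    and hom: "\<And>x c. x \<in> D \<Longrightarrow> c > 0 \<Longrightarrow> \<phi>inf (c *\<^sub>R x) = (c powr \<delta>) *\<^sub>R \<phi>inf x"
    using \<phi> by (auto simp: weakly_homogeneous_on_def positively_homogeneous_on_def)
  have xD: "x k /\<^sub>R norm (x k) \<in> D" for k
    using D(2) x(1)[of k] by (auto simp: Convex.cone_def)
  have "u \<in> D"
    using closed_sequentially[OF D(1) xD x(3)] .
  then have lead: "(\<lambda>k. \<phi>inf (x k /\<^sub>R norm (x k))) \<longlonglongrightarrow> \<phi>inf u"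
    using continuous_on_tendsto_compose[OF cont x(3)] xD by simp
  have "filterlim x (inf at_infinity (principal D)) sequentially"
    using x by (auto simp: filterlim_inf filterlim_principal intro: filterlim_norm_at_top_imp_at_infinity)
  then have err: "(\<lambda>k. e (x k) /\<^sub>R (norm (x k) powr \<delta>)) \<longlonglongrightarrow> 0"
    using filterlim_compose[OF e(2)] by blast
  have "(\<lambda>k. t k *\<^sub>R (e (x k) /\<^sub>R (norm (x k) powr \<delta>))) \<longlonglongrightarrow> 0"
  proof (rule tendsto_norm_zero_cancel, rule tendsto_sandwich[OF _ _ tendsto_const])
    show "(\<lambda>k. norm (e (x k) /\<^sub>R (norm (x k) powr \<delta>))) \<longlonglongrightarrow> 0"
      using err by (rule tendsto_norm_zero)
    show "\<forall>\<^sub>F k in sequentially. norm (t k *\<^sub>R (e (x k) /\<^sub>R (norm (x k) powr \<delta>)))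
        \<le> norm (e (x k) /\<^sub>R (norm (x k) powr \<delta>))"
    proof (intro always_eventually allI)
      fix k
      have "\<bar>t k\<bar> * norm (e (x k) /\<^sub>R (norm (x k) powr \<delta>)) \<le> norm (e (x k) /\<^sub>R (norm (x k) powr \<delta>))"
        using t[of k] by (intro mult_left_le_one_le) auto
      then show "norm (t k *\<^sub>R (e (x k) /\<^sub>R (norm (x k) powr \<delta>))) \<le> norm (e (x k) /\<^sub>R (norm (x k) powr \<delta>))"
        by (simp only: norm_scaleR)
    qed
  qed auto
  then have lim: "(\<lambda>k. \<phi>inf (x k /\<^sub>R norm (x k)) + t k *\<^sub>R (e (x k) /\<^sub>R (norm (x k) powr \<delta>))) \<longlonglongrightarrow> \<phi>inf u"
    using tendsto_add[OF lead] by fastforce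
  have "\<forall>\<^sub>F k in sequentially. norm (x k) > 0"
    using x(2) unfolding filterlim_at_top_dense by blast
  then have "\<forall>\<^sub>F k in sequentially. \<phi>inf (x k /\<^sub>R norm (x k)) + t k *\<^sub>R (e (x k) /\<^sub>R (norm (x k) powr \<delta>))
      = ((1 - t k) *\<^sub>R \<phi>inf (x k) + t k *\<^sub>R \<phi> (x k)) /\<^sub>R (norm (x k) powr \<delta>)"
  proof eventually_elim
    case (elim k)
    have "\<phi>inf (x k /\<^sub>R norm (x k)) = \<phi>inf (x k) /\<^sub>R (norm (x k) powr \<delta>)"
      using hom[OF x(1), of "inverse (norm (x k))" k] elim by (simp add: inverse_powr)
    moreover have "(1 - t k) *\<^sub>R \<phi>inf (x k) + t k *\<^sub>R \<phi> (x k) = \<phi>inf (x k) + t k *\<^sub>R e (x k)"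
      by (simp add: e(1) x(1) algebra_simps)
    ultimately show ?case
      by (simp add: scaleR_add_right mult.commute)
  qed
  then show ?thesis
    using lim by (rule Lim_transform_eventually[rotated])
qed

text \<open>The common setting of the variational inequality and the complementarity problem, to be
  instantiated with \<open>K\<close> and with its recession cone.\<close>

locale weakly_homogeneous_VI =
  fixes C K :: "'a::euclidean_space set"
    and f g finf ginf F Finf :: "'a \<Rightarrow> 'a"
    and \<delta>1 \<delta>2 :: real
  assumes C: "closed C" "convex C" "Convex.cone C"
    and K: "K \<noteq> {}" "closed K" "convex K" and K_subset: "K \<subseteq> C"
    and f: "weakly_homogeneous_on C \<delta>1 f finf"
    and g: "weakly_homogeneous_on UNIV \<delta>2 g ginf"
    and F: "continuous_on UNIV F" "\<And>x. x \<in> C \<Longrightarrow> F x = f x"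
    and Finf: "continuous_on UNIV Finf" "\<And>x. x \<in> C \<Longrightarrow> Finf x = finf x"
    and preimage: "g -` C \<subseteq> C"
    and tail: "\<forall>\<^sub>F x in at_infinity. g x - ginf x \<in> C"
    and trivial: "SOL C finf ginf (recession_cone K) = {0}"
begin

section \<open>The homotopy and the zeros of its end maps\<close>

definition "FH t x = (1 - t) *\<^sub>R Finf x + t *\<^sub>R F x"
definition "gH t x = (1 - t) *\<^sub>R ginf x + t *\<^sub>R g x"
definition "H t = natural_map (FH t) (gH t) (recession_homotopy K t)"

lemma C_scaleR: "x \<in> C \<Longrightarrow> c \<ge> 0 \<Longrightarrow> c *\<^sub>R x \<in> C"
  using C(3) by (auto simp: Convex.cone_def)

lemma C_add:
  assumes "x \<in> C" "y \<in> C"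
  shows "x + y \<in> C"
proof -
  have "(1/2) *\<^sub>R x + (1/2) *\<^sub>R y \<in> C"
    using C(2) assms by (intro convexD) auto
  then have "2 *\<^sub>R ((1/2) *\<^sub>R x + (1/2) *\<^sub>R y) \<in> C"
    by (rule C_scaleR) simp
  then show ?thesis
    by (simp add: scaleR_add_right)
qed

lemma recession_homotopy_ne:
  assumes "t \<in> {0..1}"
  shows "recession_homotopy K t \<noteq> {}"
proof -
  obtain a where "a \<in> K"
    using K by auto
  then show ?thesis
    using mem_recession_homotopy[OF zero_in_recession_cone[OF K] _ K(2,3), of a t] assms by auto
qed

lemma H_eq_0_iff:
  assumes "t \<in> {0..1}"
  shows "H t x = 0 \<longleftrightarrow>
    gH t x \<in> recession_homotopy K t \<and> (\<forall>y\<in>recession_homotopy K t. 0 \<le> FH t x \<bullet> (y - gH t x))"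
  unfolding H_def using assms
  by (intro natural_map_eq_0_iff recession_homotopy_closed_convex[OF K] recession_homotopy_ne)

lemma continuous_ginf: "continuous_on UNIV ginf"
  using g by (simp add: weakly_homogeneous_on_def positively_homogeneous_on_def)

lemma continuous_g: "continuous_on UNIV g"
proof -
  obtain e where "continuous_on UNIV e" "\<And>x. g x = ginf x + e x"
    using g by (auto simp: weakly_homogeneous_on_def)
  then show ?thesis
    using continuous_on_add[OF continuous_ginf] by (metis (no_types, lifting) continuous_on_cong)
qed

lemma continuous_on_H: "continuous_on ({0..1} \<times> UNIV) (\<lambda>(t, x). H t x)"
proof -
  have comp: "continuous_on A (\<lambda>w. \<phi> (snd w))" if "continuous_on UNIV \<phi>" for A :: "(real \<times> 'a) set" and \<phi> :: "'a \<Rightarrow> 'a"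
    by (rule continuous_on_compose2[OF that]) (auto intro: continuous_intros)
  have gH: "continuous_on A (\<lambda>w. gH (fst w) (snd w))" for A :: "(real \<times> 'a) set"
    unfolding gH_def by (intro continuous_intros comp continuous_g continuous_ginf)
  have FH: "continuous_on A (\<lambda>w. FH (fst w) (snd w))" for A :: "(real \<times> 'a) set"
    unfolding FH_def by (intro continuous_intros comp F Finf)
  have "continuous_on ({0..1} \<times> UNIV)
     (\<lambda>w. (\<lambda>(t, z). closest_point (recession_homotopy K t) z) (fst w, gH (fst w) (snd w) - FH (fst w) (snd w)))"
    by (rule continuous_on_compose2[OF continuous_on_closest_point_recession_homotopy[OF K]])
      (auto intro!: continuous_intros gH FH)
  then show ?thesis
    unfolding H_def natural_map_def case_prod_unfold by (intro continuous_on_diff gH) simp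
qed

lemma ginf_preimage:
  assumes "ginf x \<in> C"
  shows "x \<in> C"
proof (cases "x = 0")
  case True
  then show ?thesis
    using K K_subset C_scaleR[of _ 0] by auto
next
  case False
  obtain b where b: "\<And>y. norm y \<ge> b \<Longrightarrow> g y - ginf y \<in> C"
    using tail by (auto simp: eventually_at_infinity)
  define c where "c = max b 1 / norm x"
  have c: "c > 0" "norm (c *\<^sub>R x) \<ge> b"
    using False by (auto simp: c_def)
  have "ginf (c *\<^sub>R x) = (c powr \<delta>2) *\<^sub>R ginf x"
    using g c by (simp add: weakly_homogeneous_on_def positively_homogeneous_on_def)
  then have "ginf (c *\<^sub>R x) \<in> C"
    using assms by (simp add: C_scaleR)
  then have "g (c *\<^sub>R x) \<in> C"
    using C_add[OF _ b[OF c(2)]] by fastforce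
  then have "c *\<^sub>R x \<in> C"
    using preimage by auto
  then have "inverse c *\<^sub>R c *\<^sub>R x \<in> C"
    by (rule C_scaleR) (use c in auto)
  then show ?thesis
    using c by simp
qed

lemma H_0_eq: "H 0 = natural_map Finf ginf (recession_cone K)"
  by (rule ext) (simp add: H_def natural_map_def FH_def gH_def recession_homotopy_def)

lemma H_0_eq_0_iff: "H 0 x = 0 \<longleftrightarrow> x = 0"
proof -
  have "H 0 x = 0 \<longleftrightarrow> ginf x \<in> recession_cone K \<and> (\<forall>y\<in>recession_cone K. 0 \<le> Finf x \<bullet> (y - ginf x))"
    by (simp add: H_eq_0_iff FH_def gH_def recession_homotopy_def)
  also have "\<dots> \<longleftrightarrow> x \<in> SOL C finf ginf (recession_cone K)"
    using ginf_preimage recession_cone_subset[OF K_subset C(1,3)] Finf(2) by (auto simp: SOL_def)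
  finally show ?thesis
    by (simp add: trivial)
qed

lemma SOL_eq_zeros: "SOL C f g K = {x. H 1 x = 0}"
proof -
  have "H 1 x = 0 \<longleftrightarrow> g x \<in> K \<and> (\<forall>y\<in>K. 0 \<le> F x \<bullet> (y - g x))" for x
    by (simp add: H_eq_0_iff FH_def gH_def recession_homotopy_def)
  moreover have "x \<in> C" if "g x \<in> K" for x
    using that preimage K_subset by auto
  ultimately show ?thesis
    using F(2) by (auto simp: SOL_def)
qed

text \<open>This is where \<open>tail\<close> enters: it makes large zeros of every \<open>H t\<close> lie in \<open>C\<close>, where the
  arbitrary extensions agree with \<open>f\<close> and \<open>finf\<close> and growth rates are under control.\<close>

lemma zeros_in_C:
  obtains b where "\<And>t x. t \<in> {0..1} \<Longrightarrow> norm x \<ge> b \<Longrightarrow> H t x = 0 \<Longrightarrow> x \<in> C"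
proof -
  obtain b where b: "\<And>y. norm y \<ge> b \<Longrightarrow> g y - ginf y \<in> C"
    using tail by (auto simp: eventually_at_infinity)
  have "x \<in> C" if "t \<in> {0..1}" "norm x \<ge> b" "H t x = 0" for t x
  proof -
    have "gH t x \<in> C"
      using that recession_homotopy_subset[OF K_subset C(1,3), of t] by (auto simp: H_eq_0_iff)
    \<comment> \<open>This is the share of the remainder that \<open>gH t x\<close> lacks; adding it
      gives \<open>g x\<close>, to which \<open>preimage\<close> applies.\<close>
    moreover have "(1 - t) *\<^sub>R (g x - ginf x) \<in> C"
      using that b by (intro C_scaleR) auto
    ultimately have "gH t x + (1 - t) *\<^sub>R (g x - ginf x) \<in> C"
      by (rule C_add)
    also have "gH t x + (1 - t) *\<^sub>R (g x - ginf x) = g x"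
      by (simp add: gH_def algebra_simps)
    finally show ?thesis
      using preimage by auto
  qed
  then show ?thesis
    using that by blast
qed

section \<open>A priori bound on the zeros\<close>

lemma zeros_bounded:
  obtains R where "\<And>t x. t \<in> {0..1} \<Longrightarrow> norm x \<ge> R \<Longrightarrow> H t x \<noteq> 0"
proof -
  have "\<exists>R. \<forall>t\<in>{0..1}. \<forall>x. norm x \<ge> R \<longrightarrow> H t x \<noteq> 0"
  proof (rule ccontr)
    assume "\<not> ?thesis"
    then have unb: "\<And>R. \<exists>t x. t \<in> {0..1} \<and> norm x \<ge> R \<and> H t x = 0"
      by metis
    obtain b where b: "\<And>t x. t \<in> {0..1} \<Longrightarrow> norm x \<ge> b \<Longrightarrow> H t x = 0 \<Longrightarrow> x \<in> C"
      by (rule zeros_in_C) blast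
    \<comment> \<open>The bound \<open>b\<close> places the zeros in \<open>C\<close>;
      \<open>Suc k\<close> makes them nonzero from the start, so that normalising is legitimate, and
      sends their norms to infinity.\<close>
    have "\<forall>k::nat. \<exists>t x. t \<in> {0..1} \<and> norm x \<ge> max b (real (Suc k)) \<and> H t x = 0"
      using unb by blast
    then obtain T X where TX: "\<And>k. T k \<in> {0..1}" "\<And>k. norm (X k) \<ge> max b (real (Suc k))" "\<And>k. H (T k) (X k) = 0"
      by metis
    have X0: "X k \<noteq> 0" for k
      using TX(2)[of k] by auto
    have "seq_compact ({0..1::real} \<times> sphere (0 :: 'a) 1)"
      by (intro compact_imp_seq_compact compact_Times) auto
    moreover have "\<forall>k. (T k, X k /\<^sub>R norm (X k)) \<in> {0..1} \<times> sphere 0 1"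
      using TX(1) X0 by auto
    ultimately obtain l r where l: "l \<in> {0..1::real} \<times> sphere (0 :: 'a) 1" "strict_mono r"
        "((\<lambda>k. (T k, X k /\<^sub>R norm (X k))) \<circ> r) \<longlonglongrightarrow> l"
      by (rule seq_compactE)
    define t where "t k = T (r k)" for k
    define x where "x k = X (r k)" for k
    define u where "u = snd l"
    have t: "t k \<in> {0..1}" and zero: "H (t k) (x k) = 0" and pos: "norm (x k) > 0" for k
      using TX X0 by (auto simp: t_def x_def)
    have xC: "x k \<in> C" for k
      using b[OF t _ zero] TX(2)[of "r k"] by (simp add: x_def)
    have "u \<noteq> 0"
      using l(1) by (auto simp: u_def)
    have ulim: "(\<lambda>k. x k /\<^sub>R norm (x k)) \<longlonglongrightarrow> u"
      using tendsto_snd[OF l(3)] by (simp add: o_def x_def u_def)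
    have inf: "filterlim (\<lambda>k. norm (x k)) at_top sequentially"
    proof (rule filterlim_at_top_mono[OF filterlim_real_sequentially])
      have "real k \<le> norm (x k)" for k
      proof -
        have "real k \<le> real (r k)"
          using seq_suble[OF l(2)] by simp
        also have "\<dots> \<le> norm (x k)"
          using TX(2)[of "r k"] by (simp add: x_def)
        finally show ?thesis .
      qed
      then show "\<forall>\<^sub>F k in sequentially. real k \<le> norm (x k)"
        by simp
    qed
    have \<delta>: "\<delta>1 > 0" "\<delta>2 > 0"
      using f g by (auto simp: weakly_homogeneous_on_def)
    have "u \<in> C"
      using closed_sequentially[OF C(1) _ ulim] C_scaleR[OF xC] by simp
    have FH_C: "FH (t k) (x k) = (1 - t k) *\<^sub>R finf (x k) + t k *\<^sub>R f (x k)" for k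
      using F(2) Finf(2) xC by (simp add: FH_def)
    have FHlim: "(\<lambda>k. FH (t k) (x k) /\<^sub>R (norm (x k) powr \<delta>1)) \<longlonglongrightarrow> finf u"
      unfolding FH_C by (rule weakly_homogeneous_limit[OF f C(1,3) xC inf ulim t])
    have gHlim: "(\<lambda>k. gH (t k) (x k) /\<^sub>R (norm (x k) powr \<delta>2)) \<longlonglongrightarrow> ginf u"
      unfolding gH_def by (rule weakly_homogeneous_limit[OF g _ _ _ inf ulim t]) (auto simp: Convex.cone_def)
    obtain a where a: "a \<in> K"
      using K by auto
    have n2: "filterlim (\<lambda>k. norm (x k) powr \<delta>2) at_top sequentially"
    proof -
      have "filterlim (\<lambda>k. exp (\<delta>2 * ln (norm (x k)))) at_top sequentially"
        by (intro filterlim_compose[OF exp_at_top] filterlim_tendsto_pos_mult_at_top[OF tendsto_const \<delta>(2)]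
            filterlim_compose[OF ln_at_top inf])
      then show ?thesis
        using pos by (simp add: powr_def)
    qed
    then have inv: "(\<lambda>k. inverse (norm (x k) powr \<delta>2)) \<longlonglongrightarrow> 0"
      by (rule tendsto_inverse_0_at_top)
    \<comment> \<open>The corrections by multiples of \<open>a\<close> that move points between the
      levels disappear after rescaling.\<close>
    have small: "(\<lambda>k. (c k *\<^sub>R a) /\<^sub>R (norm (x k) powr \<delta>2)) \<longlonglongrightarrow> 0" if "\<And>k. c k \<in> {0..1}" for c
    proof (rule lim_null_scaleR_bounded[OF inv])
      have "norm (c k *\<^sub>R a) \<le> norm a" for k
        using that[of k] mult_left_le_one_le[of "norm a" "c k"] by simp
      then show "\<forall>\<^sub>F k in sequentially. inverse (norm (x k) powr \<delta>2) = 0 \<or> norm (c k *\<^sub>R a) \<le> norm a"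
        by simp
    qed
    have "ginf u \<in> recession_cone K"
    proof -
      \<comment> \<open>The correction lifts the point from level \<open>t k\<close> to level 1,
        which is \<open>K\<close> itself. Dividing by the unbounded factors
        \<open>norm (x k) powr \<delta>2\<close> then exhibits \<open>ginf u\<close> as a recession
        direction.\<close>
      have "gH (t k) (x k) + (1 - t k) *\<^sub>R a \<in> K" for k
        using recession_homotopy_add[of "gH (t k) (x k)" K "t k" a "1 - t k"] t[of k] zero[of k] a K
        by (auto simp: H_eq_0_iff recession_homotopy_def[of K 1])
      moreover have "(\<lambda>k. (gH (t k) (x k) + (1 - t k) *\<^sub>R a) /\<^sub>R (norm (x k) powr \<delta>2)) \<longlonglongrightarrow> ginf u"
        using tendsto_add[OF gHlim small[of "\<lambda>k. 1 - t k"]] t by (simp add: scaleR_add_right)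
      ultimately show ?thesis
        using n2 by (intro recession_coneI)
    qed
    moreover have "0 \<le> finf u \<bullet> (y - ginf u)" if y: "y \<in> recession_cone K" for y
    proof -
      \<comment> \<open>test the variational inequality at \<open>norm (x k) powr \<delta>2 *\<^sub>R y + t k *\<^sub>R a\<close> and rescale by
        \<open>norm (x k) powr (\<delta>1 + \<delta>2)\<close>\<close>
      define d where "d k = (y - gH (t k) (x k) /\<^sub>R (norm (x k) powr \<delta>2)) + (t k *\<^sub>R a) /\<^sub>R (norm (x k) powr \<delta>2)" for k
      have "d \<longlonglongrightarrow> y - ginf u + 0"
        unfolding d_def by (intro tendsto_add tendsto_diff tendsto_const gHlim small t)
      then have "(\<lambda>k. (FH (t k) (x k) /\<^sub>R (norm (x k) powr \<delta>1)) \<bullet> d k) \<longlonglongrightarrow> finf u \<bullet> (y - ginf u)"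
        using tendsto_inner[OF FHlim] by fastforce
      moreover have "0 \<le> (FH (t k) (x k) /\<^sub>R (norm (x k) powr \<delta>1)) \<bullet> d k" for k
      proof -
        define n where "n = norm (x k) powr \<delta>2"
        have n: "n > 0"
          using pos[of k] by (simp add: n_def)
        have "n *\<^sub>R y + t k *\<^sub>R a \<in> recession_homotopy K (t k)"
          using t[of k] n by (intro mem_recession_homotopy recession_cone_scaleR y a K) auto
        then have "0 \<le> FH (t k) (x k) \<bullet> (n *\<^sub>R y + t k *\<^sub>R a - gH (t k) (x k))"
          using H_eq_0_iff[OF t] zero by blast
        moreover have "n *\<^sub>R d k = n *\<^sub>R y + t k *\<^sub>R a - gH (t k) (x k)"
          using n by (simp add: d_def n_def[symmetric] scaleR_add_right scaleR_diff_right)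
        ultimately have "0 \<le> n * (FH (t k) (x k) \<bullet> d k)"
          by (metis inner_scaleR_right)
        then show ?thesis
          using n by (simp add: zero_le_mult_iff)
      qed
      ultimately show ?thesis
        by (intro LIMSEQ_le_const) auto
    qed
    ultimately have "u \<in> SOL C finf ginf (recession_cone K)"
      using \<open>u \<in> C\<close> by (simp add: SOL_def)
    then show False
      using trivial \<open>u \<noteq> 0\<close> by simp
  qed
  then show ?thesis
    using that by blast
qed

section \<open>Compactness and existence of solutions\<close>

lemma compact_SOL: "compact (SOL C f g K)"
proof -
  obtain R where R: "\<And>t x. t \<in> {0..1} \<Longrightarrow> norm x \<ge> R \<Longrightarrow> H t x \<noteq> 0"
    by (rule zeros_bounded) blast
  have "norm x \<le> R" if "H 1 x = 0" for x
    using R[of 1 x] that by force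
  then have "bounded (SOL C f g K)"
    by (auto simp: SOL_eq_zeros bounded_iff)
  moreover have "continuous_on UNIV (\<lambda>x. (\<lambda>(t, x). H t x) (1, x))"
    by (rule continuous_on_compose2[OF continuous_on_H]) (auto intro!: continuous_on_Pair continuous_intros)
  then have "closed (H 1 -` {0})"
    by (intro closed_vimage) auto
  then have "closed (SOL C f g K)"
    by (simp add: SOL_eq_zeros vimage_def)
  ultimately show ?thesis
    by (simp add: compact_eq_bounded_closed)
qed

lemma SOL_nonempty:
  assumes "brouwer_index (natural_map Finf ginf (recession_cone K)) 0 \<noteq> 0"
  shows "SOL C f g K \<noteq> {}"
proof -
  obtain R where R: "\<And>t x. t \<in> {0..1} \<Longrightarrow> norm x \<ge> R \<Longrightarrow> H t x \<noteq> 0"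
    by (rule zeros_bounded) blast
  obtain x where "H 1 x = 0"
    using brouwer_index_homotopy_zero[OF continuous_on_H H_0_eq_0_iff R] assms by (auto simp: H_0_eq)
  then show ?thesis
    by (auto simp: SOL_eq_zeros)
qed

end

section \<open>Application to the variational inequality and the complementarity problem\<close>

theorem mainTheorem6:
  fixes C K :: "'a::euclidean_space set"
    and f g finf ginf fbar gbar F Finf :: "'a \<Rightarrow> 'a"
    and p q :: 'a
    and \<delta>1 \<delta>2 :: real
  assumes C: "closed C" "convex C" "Convex.cone C"
    and K: "K \<noteq> {}" "closed K" "convex K" "K \<subseteq> C"
    and f: "weakly_homogeneous_on C \<delta>1 f finf"
    and g: "weakly_homogeneous_on UNIV \<delta>2 g ginf"
    and f_decomp: "\<And>x. x \<in> C \<Longrightarrow> f x = finf x + fbar x + p"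
    and g_decomp: "\<And>x. g x = ginf x + gbar x + q"
    and F: "continuous_on UNIV F" "\<And>x. x \<in> C \<Longrightarrow> F x = f x"
    and Finf: "continuous_on UNIV Finf" "\<And>x. x \<in> C \<Longrightarrow> Finf x = finf x"
    and preimage: "g -` C \<subseteq> C"
    and tail: "\<forall>\<^sub>F x in at_infinity. gbar x + q \<in> C"
    and a: "SOL C finf ginf (recession_cone K) = {0}"
    and b: "brouwer_index (natural_map Finf ginf (recession_cone K)) 0 \<noteq> 0"
  shows "SOL C f g K \<noteq> {} \<and> compact (SOL C f g K) \<and>
         GCP_solutions C f g (recession_cone K) \<noteq> {} \<and>
         compact (GCP_solutions C f g (recession_cone K))"
proof -
  note K' = K(1-3)
  have tail': "\<forall>\<^sub>F x in at_infinity. g x - ginf x \<in> C"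
    using tail by eventually_elim (simp add: g_decomp algebra_simps)
  interpret VI: weakly_homogeneous_VI C K f g finf ginf F Finf \<delta>1 \<delta>2
    using C K f g F Finf preimage tail' a by unfold_locales auto
  have zero: "0 \<in> recession_cone K"
    by (rule zero_in_recession_cone[OF K'])
  interpret CP: weakly_homogeneous_VI C "recession_cone K" f g finf ginf F Finf \<delta>1 \<delta>2
    using C f g F Finf preimage tail' a zero closed_recession_cone[OF K'] convex_recession_cone[OF K']
      recession_cone_subset[OF K(4) C(1,3)]
    by unfold_locales (auto simp: recession_cone_idem[OF K'])
  have "GCP_solutions C f g (recession_cone K) = SOL C f g (recession_cone K)"
    using zero recession_cone_scaleR by (rule GCP_solutions_eq_SOL)
  then show ?thesis
    using VI.SOL_nonempty VI.compact_SOL CP.SOL_nonempty CP.compact_SOL b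
    by (simp add: recession_cone_idem[OF K'])
qed

end
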